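(* Let $n\ge 3$ and $\pi>0$. If $a>0$, there exists a level-preserving homeomorphism $$\Psi_+:\mathcal{C}_a\longrightarrow \mathcal{C}_\pi|_{\mathcal{A}>0}=\{P\in\mathcal{C}_\pi:\mathcal{A}(P)>0\}$$ which sends Morse points of index $i$ (of $\mathcal{P}|_{\mathcal{C}_a}$) to Morse points of index $2n-4-i$ (of $\mathcal{A}|_{\mathcal{C}_\pi}$). If $a<0$, there exists an analogous level-preserving homeomorphism $$\Psi_-:\mathcal{C}_a\longrightarrow \mathcal{C}_\pi|_{\mathcal{A}<0}=\{P\in\mathcal{C}_\pi:\mathcal{A}(P)<0\}$$ which preserves Morse indices.
   Context: An $n$-gon is an $n$-tuple of points $(p_1,\dots,p_n)\in(\mathbb{R}^2)^n$, not all equal (but some may coincide), modulo the diagonal action of orientation-preserving isometries of the plane; $\mathcal{C}$ is the space of all $n$-gons. Perimeter: $\mathcal{P}(p_1,\dots,p_n)=|p_1p_2|+|p_2p_3|+\dots+|p_np_1|>0$. Oriented area: $2\mathcal{A}(p_1,\dots,p_n)=x_1y_2-x_2y_1+\dots+x_ny_1-x_1y_n$, $p_i=(x_i,y_i)$. $\mathcal{C}_\pi=\{\mathcal{P}=\pi\}$ is the space of $n$-gons with fixed perimeter $\pi$ (a positive real number, not $3.14\ldots$) and $\mathcal{C}_a=\{\mathcal{A}=a\}$ is the space of $n$-gons with fixed oriented area $a$. Level-preserving: $\Psi_\pm$ carries level sets of $\mathcal{P}|_{\mathcal{C}_a}$ to level sets of $\mathcal{A}|_{\mathcal{C}_\pi}$;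 i.e. there is a homeomorphism $h:\mathbb{R}_{>0}\to\mathbb{R}_{>0}$ (for $a>0$; $h:\mathbb{R}_{>0}\to\mathbb{R}_{<0}$ for $a<0$) with $\mathcal{A}\circ\Psi_\pm=h\circ\mathcal{P}$ on $\mathcal{C}_a$. Morse points are the critical points of the function $\mathcal{P}|_{\mathcal{C}_a}$ on the source and of $\mathcal{A}|_{\mathcal{C}_\pi}$ on the target; their index is the Morse index of the respective function. (At polygons with $p_i=p_{i+1}$ for some $i$, where $\mathcal{P}$ is not differentiable, criticality is meant in the sense of Clarke; all such points are regular.) *)

theory Defs
  imports "HOL-Analysis.Analysis"
begin

section \<open>Tuples of points in the plane\<close>

text \<open>
  An \<open>n\<close>-tuple of points of the plane is a vector indexed by a finite type of cardinality \<open>n\<close>.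
  The cyclic order of the vertices comes from the enumeration \<^const>\<open>from_nat_into\<close> of the index
  type, which is a bijection from \<open>{..<n}\<close> for a finite type. Since every finite cardinality is
  realised by some type, nothing depends on which enumeration this is.
\<close>

definition vertex :: "(real^2)^'n \<Rightarrow> nat \<Rightarrow> real^2"
  where "vertex p k = p $ from_nat_into (UNIV :: 'n set) (k mod CARD('n))"

definition perimeter :: "(real^2)^'n \<Rightarrow> real"
  where "perimeter p = (\<Sum>k<CARD('n). dist (vertex p k) (vertex p (Suc k)))"

definition area :: "(real^2)^'n \<Rightarrow> real"
  where "area p = (\<Sum>k<CARD('n). vertex p k $ 1 * vertex p (Suc k) $ 2
                                 - vertex p (Suc k) $ 1 * vertex p k $ 2) / 2"


section \<open>Polygons modulo orientation-preserving isometries\<close>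

definition congruent_tuples :: "(real^2)^'n \<Rightarrow> (real^2)^'n \<Rightarrow> bool"
  where "congruent_tuples p q \<longleftrightarrow>
    (\<exists>Q b. rotation_matrix Q \<and> (\<forall>i. q $ i = Q *v (p $ i) + b))"

lemma congruent_tuples_refl: "congruent_tuples p p"
  unfolding congruent_tuples_def
  by (rule exI[of _ "mat 1"], rule exI[of _ 0])
    (simp add: rotation_matrix_def orthogonal_matrix_id)

lemma congruent_tuples_sym:
  assumes "congruent_tuples p q"
  shows "congruent_tuples q p"
proof -
  obtain Q b where Q: "rotation_matrix Q" and q: "\<And>i. q $ i = Q *v (p $ i) + b"
    using assms unfolding congruent_tuples_def by blast
  have "rotation_matrix (transpose Q)"
    using Q by (simp add: rotation_matrix_def orthogonal_matrix_transpose)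
  moreover have "p $ i = transpose Q *v (q $ i) + - (transpose Q *v b)" for i
    using Q by (simp add: q rotation_matrix_def orthogonal_matrix matrix_vector_right_distrib
        matrix_vector_mul_assoc)
  ultimately show ?thesis
    unfolding congruent_tuples_def by blast
qed

lemma congruent_tuples_trans:
  assumes "congruent_tuples p q" "congruent_tuples q r"
  shows "congruent_tuples p r"
proof -
  obtain Q b where Q: "rotation_matrix Q" and q: "\<And>i. q $ i = Q *v (p $ i) + b"
    using assms unfolding congruent_tuples_def by blast
  obtain R c where R: "rotation_matrix R" and r: "\<And>i. r $ i = R *v (q $ i) + c"
    using assms unfolding congruent_tuples_def by blast
  have "rotation_matrix (R ** Q)"
    using Q R by (simp add: rotation_matrix_def orthogonal_matrix_mul det_mul)
  moreover have "r $ i = (R ** Q) *v (p $ i) + (R *v b + c)" for i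
    by (simp add: q r matrix_vector_right_distrib matrix_vector_mul_assoc)
  ultimately show ?thesis
    unfolding congruent_tuples_def by blast
qed

text \<open>
  The type of all tuples (including the constant ones, which are excluded in \<open>ngons\<close> below)
  modulo the diagonal action, with the quotient topology.
\<close>

quotient_type 'n polygon = "(real^2)^'n" / congruent_tuples
  morphisms rep_polygon polygon_of
  by (intro equivpI reflpI sympI transpI)
    (blast intro: congruent_tuples_refl congruent_tuples_sym congruent_tuples_trans)+

instantiation polygon :: (finite) topological_space
begin

definition open_polygon :: "'a polygon set \<Rightarrow> bool"
  where "open_polygon U \<longleftrightarrow> open (polygon_of -` U)"

instance
  by intro_classes (auto simp: open_polygon_def vimage_Union)

end

lemma rotation_matrix_2_entries:
  fixes Q :: "real^2^2"
  assumes "rotation_matrix Q"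
  shows "Q$1$1 * Q$2$2 - Q$1$2 * Q$2$1 = 1"
  using assms by (simp add: rotation_matrix_def det_2)

lemma vertex_congruent:
  assumes "\<And>i. q $ i = Q *v (p $ i) + b"
  shows "vertex q k = Q *v (vertex p k) + b"
  by (simp add: vertex_def assms)

lemma perimeter_congruent:
  fixes p q :: "(real^2)^'n"
  assumes "congruent_tuples p q"
  shows "perimeter p = perimeter q"
proof -
  obtain Q b where Q: "rotation_matrix Q" and q: "\<And>i. q $ i = Q *v (p $ i) + b"
    using assms unfolding congruent_tuples_def by blast
  have "orthogonal_transformation ((*v) Q)"
    using Q by (simp add: rotation_matrix_def orthogonal_transformation_matrix)
  then have "dist (Q *v x + b) (Q *v y + b) = dist x y" for x y
    by (simp add: dist_norm orthogonal_transformation_norm flip: matrix_vector_mult_diff_distrib)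
  then show ?thesis
    by (simp add: perimeter_def vertex_congruent[OF q])
qed

lemma area_congruent:
  fixes p q :: "(real^2)^'n"
  assumes "congruent_tuples p q"
  shows "area p = area q"
proof -
  obtain Q b where Q: "rotation_matrix Q" and q: "\<And>i. q $ i = Q *v (p $ i) + b"
    using assms unfolding congruent_tuples_def by blast
  define g where "g = (\<lambda>x::real^2. (Q *v x) $ 1 * b $ 2 - (Q *v x) $ 2 * b $ 1)"
  have step: "(Q *v x + b) $ 1 * (Q *v y + b) $ 2 - (Q *v y + b) $ 1 * (Q *v x + b) $ 2
      = (x $ 1 * y $ 2 - y $ 1 * x $ 2) + (g x - g y)" for x y
  proof -
    have "(Q *v x + b) $ 1 * (Q *v y + b) $ 2 - (Q *v y + b) $ 1 * (Q *v x + b) $ 2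
      = (Q$1$1 * Q$2$2 - Q$1$2 * Q$2$1) * (x $ 1 * y $ 2 - y $ 1 * x $ 2) + (g x - g y)"
      by (simp add: g_def matrix_vector_mult_def sum_2 algebra_simps)
    then show ?thesis
      by (simp add: rotation_matrix_2_entries[OF Q])
  qed
  have "(\<Sum>k<CARD('n). g (vertex p k) - g (vertex p (Suc k))) =
      g (vertex p 0) - g (vertex p CARD('n))"
    by (rule sum_lessThan_telescope')
  also have "\<dots> = 0"
    by (simp add: vertex_def)
  finally show ?thesis
    unfolding area_def vertex_congruent[OF q] step sum.distrib by simp
qed

lift_definition polygon_perimeter :: "'n::finite polygon \<Rightarrow> real" is perimeter
  by (rule perimeter_congruent)

lift_definition polygon_area :: "'n::finite polygon \<Rightarrow> real" is area
  by (rule area_congruent)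

definition ngons :: "'n::finite polygon set"
  where "ngons = polygon_of ` {p. \<exists>i j. p $ i \<noteq> p $ j}"

definition ngons_area :: "real \<Rightarrow> 'n::finite polygon set"
  where "ngons_area a = {X \<in> ngons. polygon_area X = a}"

definition ngons_perimeter :: "real \<Rightarrow> 'n::finite polygon set"
  where "ngons_perimeter c = {X \<in> ngons. polygon_perimeter X = c}"


section \<open>Clarke's generalized gradient\<close>

definition clarke_derivative :: "('a::real_normed_vector \<Rightarrow> real) \<Rightarrow> 'a \<Rightarrow> 'a \<Rightarrow> ereal"
  where "clarke_derivative f x v =
    Limsup (nhds x \<times>\<^sub>F at_right 0) (\<lambda>(y, t). ereal ((f (y + t *\<^sub>R v) - f y) / t))"

definition clarke_gradient :: "('a::real_inner \<Rightarrow> real) \<Rightarrow> 'a \<Rightarrow> 'a set"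
  where "clarke_gradient f x = {\<xi>. \<forall>v. ereal (\<xi> \<bullet> v) \<le> clarke_derivative f x v}"


section \<open>Critical points and Morse index on level sets\<close>

text \<open>
  The tangent space at \<open>p\<close> of the orbit under orientation-preserving isometries is spanned by the
  translations and the infinitesimal rotation. Its orthogonal complement is the model used here for
  the tangent space, at the class of \<open>p\<close>, of the space of polygons (of dimension \<open>2n - 3\<close>).
\<close>

definition orbit_directions :: "(real^2)^'n \<Rightarrow> ((real^2)^'n) set"
  where "orbit_directions p =
    {w. \<exists>b c. \<forall>i. w $ i = b + c *\<^sub>R vector [- (p $ i $ 2), p $ i $ 1]}"

abbreviation horizontal_space :: "(real^2)^'n::finite \<Rightarrow> ((real^2)^'n) set"
  where "horizontal_space p \<equiv> orthogonal_comp (orbit_directions p)"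

text \<open>
  Below, \<open>f\<close> is the function under consideration and \<open>g\<close> defines the level set \<open>{g = g p}\<close> to
  which it is restricted. The point \<open>p\<close> is critical if some generalized gradient of \<open>f\<close> vanishes on
  the tangent hyperplane of the level set, i.e. on the kernel of a generalized gradient of \<open>g\<close>. If
  \<open>f\<close> and \<open>g\<close> are continuously differentiable near \<open>p\<close>, the generalized gradients are the ordinary
  ones, and this says that the derivative of \<open>f\<close> is zero on the tangent space of the level set.
  When \<open>g\<close> is not differentiable at \<open>p\<close>, the level set has no tangent hyperplane, and the condition
  is Clarke's multiplier rule.
\<close>

definition clarke_critical_on_level ::
  "((real^2)^'n \<Rightarrow> real) \<Rightarrow> ((real^2)^'n \<Rightarrow> real) \<Rightarrow> (real^2)^'n::finite \<Rightarrow> bool"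
  where "clarke_critical_on_level f g p \<longleftrightarrow>
    (\<exists>\<xi> \<in> clarke_gradient f p. \<exists>\<eta> \<in> clarke_gradient g p.
       \<forall>v \<in> horizontal_space p. \<eta> \<bullet> v = 0 \<longrightarrow> \<xi> \<bullet> v = 0)"

text \<open>Twice continuously differentiable curves in the level set, from \<open>p\<close> with velocity \<open>v\<close>.\<close>

definition level_curve ::
  "('a::real_normed_vector \<Rightarrow> real) \<Rightarrow> 'a \<Rightarrow> 'a \<Rightarrow> (real \<Rightarrow> 'a) \<Rightarrow> bool"
  where "level_curve g p v \<gamma> \<longleftrightarrow>
    (\<exists>\<epsilon>>0. \<exists>\<gamma>' \<gamma>''.
       (\<forall>t \<in> {-\<epsilon><..<\<epsilon>}. (\<gamma> has_vector_derivative \<gamma>' t) (at t) \<and>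
          (\<gamma>' has_vector_derivative \<gamma>'' t) (at t) \<and> g (\<gamma> t) = g p) \<and>
       continuous_on {-\<epsilon><..<\<epsilon>} \<gamma>'' \<and> \<gamma> 0 = p \<and> \<gamma>' 0 = v)"

definition level_tangent_space ::
  "((real^2)^'n \<Rightarrow> real) \<Rightarrow> (real^2)^'n::finite \<Rightarrow> ((real^2)^'n) set"
  where "level_tangent_space g p = {v \<in> horizontal_space p. \<exists>\<gamma>. level_curve g p v \<gamma>}"

text \<open>
  The Hessian of the restriction at a critical point, as a quadratic form: the second derivative of
  \<open>f\<close> along any curve in the level set with velocity \<open>v\<close>. At a critical point (with \<open>f\<close> and \<open>g\<close>
  smooth near it) this does not depend on the curve.
\<close>

definition level_hessian ::
  "('a::real_normed_vector \<Rightarrow> real) \<Rightarrow> ('a \<Rightarrow> real) \<Rightarrow> 'a \<Rightarrow> 'a \<Rightarrow> real"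
  where "level_hessian f g p v =
    (THE d. \<exists>\<gamma>. level_curve g p v \<gamma> \<and> d = deriv (deriv (f \<circ> \<gamma>)) 0)"

definition morse_index ::
  "((real^2)^'n \<Rightarrow> real) \<Rightarrow> ((real^2)^'n \<Rightarrow> real) \<Rightarrow> (real^2)^'n::finite \<Rightarrow> nat"
  where "morse_index f g p =
    Max {dim V |V. subspace V \<and> V \<subseteq> level_tangent_space g p \<and>
                   (\<forall>v \<in> V - {0}. level_hessian f g p v < 0)}"

text \<open>
  \<open>morse_point f g X i\<close>: the polygon \<open>X\<close> is a critical point of index \<open>i\<close> of the restriction of \<open>f\<close>
  to the level set of \<open>g\<close> through \<open>X\<close>. For functions \<open>f\<close> and \<open>g\<close> that are invariant under
  orientation-preserving isometries, the choice of the representative \<open>p\<close> is immaterial.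
\<close>

definition morse_point ::
  "((real^2)^'n \<Rightarrow> real) \<Rightarrow> ((real^2)^'n \<Rightarrow> real) \<Rightarrow> 'n::finite polygon \<Rightarrow> nat \<Rightarrow> bool"
  where "morse_point f g X i \<longleftrightarrow>
    (\<exists>p. X = polygon_of p \<and> clarke_critical_on_level f g p \<and> morse_index f g p = i)"

end

theory Submission
  imports Defs
begin

text \<open>
  Both maps are rescalings: \<open>X\<close> of area \<open>a\<close> and perimeter \<open>P\<close> goes to \<open>(\<pi> / P) X\<close>, of area
  \<open>\<pi>\<^sup>2 a / P\<^sup>2\<close>. A critical point of perimeter at fixed area is a tuple with nonvanishing edges
  at which \<open>dP = \<mu> dA\<close>, where \<open>\<mu> = P / (2 a)\<close> by Euler's identity. On the common tangent space
  \<open>T\<close> of the two level sets, the Hessian of perimeter is \<open>H = D\<^sup>2P - \<mu> D\<^sup>2A\<close> and that of area is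
  \<open>- H / \<mu>\<close>. If \<open>a < 0\<close>, the two forms have the same sign; if \<open>a > 0\<close>, the two indices add up to
  \<open>dim T = 2n - 4\<close>, provided \<open>H\<close> is nondegenerate on \<open>T\<close>.

  For nondegeneracy, write the variation of the \<open>k\<close>-th edge as \<open>\<alpha>\<^sub>k u\<^sub>k + \<beta>\<^sub>k rot u\<^sub>k\<close> in the frame
  of the unit edge vector \<open>u\<^sub>k\<close>. At a critical point all edges have the same length \<open>l\<close>, and with
  \<open>\<tau> = \<mu> l / 2\<close> the kernel equation becomes \<open>\<alpha>\<^sub>k\<^sub>+\<^sub>1 = \<alpha>\<^sub>k = \<alpha>\<close> and
  \<open>(1 + \<tau>\<^sup>2) (\<beta>\<^sub>k\<^sub>+\<^sub>1 - \<beta>\<^sub>k) = 2 \<tau> \<alpha>\<close>. Summing around the polygon gives \<open>\<alpha> = 0\<close>, so \<open>\<beta>\<close> is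
  constant and the variation is an infinitesimal isometry.
\<close>

section \<open>Index and coindex of a nondegenerate form\<close>

text \<open>Orthogonality to \<open>A\<close> costs at most \<open>dim A\<close> dimensions: the
  orthogonal complement of \<open>A\<close> in the whole space has codimension \<open>dim A\<close>,
  and the dimension formula for sums controls its intersection with \<open>T\<close>.\<close>

lemma dim_orthogonal_within_ge:
  fixes T A :: "'a::euclidean_space set"
  assumes "subspace T" "subspace A"
  shows "dim T \<le> dim {y \<in> T. \<forall>x\<in>A. orthogonal x y} + dim A"
proof -
  let ?O = "{y \<in> UNIV. \<forall>x\<in>A. orthogonal x y}"
  have O: "subspace ?O"
    by (auto simp: subspace_def orthogonal_def inner_add_right)
  have "dim ?O + dim A = DIM('a)"
    using dim_subspace_orthogonal_to_vectors[of A UNIV] assms by simp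
  moreover have "dim {x + y |x y. x \<in> T \<and> y \<in> ?O} + dim (T \<inter> ?O) = dim T + dim ?O"
    by (rule dim_sums_Int[OF assms(1) O])
  moreover have "dim {x + y |x y. x \<in> T \<and> y \<in> ?O} \<le> DIM('a)"
    by (rule dim_subset_UNIV)
  moreover have "T \<inter> ?O = {y \<in> T. \<forall>x\<in>A. orthogonal x y}" by auto
  ultimately show ?thesis by simp
qed

text \<open>The nonnegative semidefinite complement of a maximal negative definite subspace is
  positive definite by the Cauchy-Schwarz inequality and nondegeneracy.\<close>

lemma index_add_coindex:
  fixes B :: "'a::euclidean_space \<Rightarrow> 'a \<Rightarrow> real"
  assumes T: "subspace T" and B: "bilinear B" and sym: "\<And>v w. B v w = B w v"
    and nondeg: "\<And>v. v \<in> T \<Longrightarrow> (\<And>w. w \<in> T \<Longrightarrow> B v w = 0) \<Longrightarrow> v = 0"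
  shows "Max {dim V |V. subspace V \<and> V \<subseteq> T \<and> (\<forall>v\<in>V - {0}. B v v < 0)} +
    Max {dim V |V. subspace V \<and> V \<subseteq> T \<and> (\<forall>v\<in>V - {0}. B v v > 0)} = dim T"
    (is "Max ?N + Max ?P = _")
proof -
  have lin1: "B (x + y) z = B x z + B y z" "B (c *\<^sub>R x) z = c * B x z"
    and lin2: "B z (x + y) = B z x + B z y" "B z (c *\<^sub>R x) = c * B z x"
    and lin0: "B 0 z = 0" "B z 0 = 0" for x y z c
    using B bilinear_ladd[OF B] bilinear_radd[OF B] bilinear_lmul[OF B] bilinear_rmul[OF B]
      bilinear_lzero[OF B] bilinear_rzero[OF B] by auto
  \<comment> \<open>The zero space makes \<open>?N\<close> nonempty, so that its maximum is attained
    by some \<open>V\<close>.\<close>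
  have "subspace {0::'a}" "{0} \<subseteq> T"
    using T by (auto simp: subspace_0)
  then have "dim {0::'a} \<in> ?N" by blast
  moreover have finN: "finite ?N"
    by (rule finite_subset[of _ "{..DIM('a)}"]) (auto simp: dim_subset_UNIV)
  ultimately have "Max ?N \<in> ?N"
    using Max_in by blast
  then obtain V where V: "subspace V" "V \<subseteq> T" "\<And>v. v \<in> V \<Longrightarrow> v \<noteq> 0 \<Longrightarrow> B v v < 0"
    and Vmax: "dim V = Max ?N"
    by force
  define W where "W = {x \<in> T. \<forall>v\<in>V. B v x = 0}"
  have subW: "subspace W"
    using T by (auto simp: W_def subspace_def lin1 lin2 lin0)
  have disj: "V \<inter> W = {0}"
    using V(3) subspace_0[OF V(1)] subspace_0[OF subW] by (force simp: W_def)
  \<comment> \<open>\<open>L v\<close> is the Riesz vector of the functional \<open>B v\<close>. It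
    turns complements for \<open>B\<close> into orthogonal complements, whose dimension can be
    counted.\<close>
  define L where "L v = (\<Sum>b\<in>Basis. B v b *\<^sub>R b)" for v
  have L: "L v \<bullet> x = B v x" for v x
  proof -
    have "B v x = B v (\<Sum>b\<in>Basis. (x \<bullet> b) *\<^sub>R b)"
      by (simp add: euclidean_representation)
    also have "\<dots> = (\<Sum>b\<in>Basis. (x \<bullet> b) * B v b)"
      using B by (simp add: bilinear_def linear_sum linear_cmul)
    also have "\<dots> = L v \<bullet> x"
      by (simp add: L_def inner_sum_left inner_commute[of x] mult.commute)
    finally show ?thesis by simp
  qed
  have linL: "linear L"
    by (rule linearI; rule vector_eq_rdot[THEN iffD1]) (auto simp: L lin1 inner_add_left)
  have "dim T \<le> dim {y \<in> T. \<forall>x\<in>L ` V. orthogonal x y} + dim (L ` V)"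
    by (rule dim_orthogonal_within_ge[OF T]) (simp add: linear_subspace_image linL V)
  moreover have "{y \<in> T. \<forall>x\<in>L ` V. orthogonal x y} = W"
    by (auto simp: W_def orthogonal_def L)
  moreover have "dim (L ` V) \<le> dim V"
    by (rule dim_image_le[OF linL])
  ultimately have dimW: "dim T \<le> dim W + dim V" by simp
  let ?S = "{x + y |x y. x \<in> V \<and> y \<in> W}"
  have dimS: "dim ?S = dim V + dim W"
    using dim_sums_Int[OF V(1) subW] disj by simp
  have ST: "?S = T"
  proof (rule subspace_dim_equal)
    show "subspace ?S" by (rule subspace_sums[OF V(1) subW])
    show "?S \<subseteq> T"
      using V(2) T by (auto simp: W_def subspace_add subset_iff)
  qed (use T dimS dimW in auto)
  \<comment> \<open>A vector of \<open>W\<close> with negative value could be added to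
    \<open>V\<close> without losing negative definiteness, against the maximality of
    \<open>V\<close>.\<close>
  have nonneg: "B w w \<ge> 0" if w: "w \<in> W" for w
  proof (rule ccontr)
    assume neg: "\<not> B w w \<ge> 0"
    then have w0: "w \<noteq> 0" by (auto simp: lin0)
    let ?U = "{x + y |x y. x \<in> V \<and> y \<in> span {w}}"
    have "span {w} \<subseteq> W" using w subW by (simp add: span_minimal)
    then have "V \<inter> span {w} = {0}"
      using disj subspace_0[OF V(1)] span_0 by blast
    then have "dim ?U = dim V + 1"
      using dim_sums_Int[OF V(1) subspace_span, of "{w}"] w0 by simp
    moreover have "subspace ?U" by (rule subspace_sums[OF V(1) subspace_span])
    moreover have "?U \<subseteq> T"
      using \<open>span {w} \<subseteq> W\<close> ST by blast
    moreover have "B u u < 0" if u: "u \<in> ?U" "u \<noteq> 0" for u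
    proof -
      obtain x c where x: "x \<in> V" "u = x + c *\<^sub>R w"
        using u by (auto simp: span_singleton)
      have Bxw: "B x w = 0" using w x by (simp add: W_def)
      have "B u u = B x x + c * c * B w w"
        by (simp add: x lin1 lin2 Bxw sym[of w x])
      moreover have "B x x < 0 \<or> x = 0" using V(3) x by blast
      moreover have "c * c * B w w < 0 \<or> c = 0"
        using neg by (simp add: mult_less_0_iff zero_less_mult_iff) linarith
      ultimately show ?thesis
        using x u(2) by (auto simp: lin0)
    qed
    ultimately have "dim V + 1 \<in> ?N"
      by (intro CollectI exI[of _ ?U] conjI ballI) (simp_all only: Diff_iff singleton_iff not_False_eq_True)
    from Max_ge[OF finN this] show False using Vmax by simp
  qed
  have posW: "B w w > 0" if w: "w \<in> W" "w \<noteq> 0" for w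
  proof (rule ccontr)
    assume "\<not> B w w > 0"
    then have ww: "B w w = 0" using nonneg[OF w(1)] by simp
    have zero: "B w x = 0" if x: "x \<in> W" for x
    proof (rule ccontr)
      assume nz: "B w x \<noteq> 0"
      \<comment> \<open>As \<open>B w w = 0\<close>, the form at \<open>c w + x\<close> is affine in
        \<open>c\<close>. Nonnegativity for every \<open>c\<close> forces slope 0; the value of
        \<open>c\<close> inserted below would give -1.\<close>
      have q: "0 \<le> 2 * c * B w x + B x x" for c
      proof -
        have "c *\<^sub>R w + x \<in> W"
          using w x subW by (simp add: subspace_add subspace_scale)
        from nonneg[OF this] show ?thesis
          by (simp add: lin1 lin2 ww sym[of x w])
      qed
      show False
        using q[of "- (B x x + 1) / (2 * B w x)"] nz by (simp add: field_simps)
    qed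
    have "B w t = 0" if "t \<in> T" for t
    proof -
      obtain x y where "x \<in> V" "y \<in> W" "t = x + y"
        using \<open>t \<in> T\<close> ST by blast
      then show ?thesis
        using w by (simp add: lin2 zero sym[of w x]) (simp add: W_def)
    qed
    then show False using nondeg[of w] w by (simp add: W_def)
  qed
  have finP: "finite ?P"
    by (rule finite_subset[of _ "{..DIM('a)}"]) (auto simp: dim_subset_UNIV)
  have "Max ?P = dim W"
  proof (rule Max_eqI[OF finP])
    show "dim W \<in> ?P"
      using subW posW by (auto simp: W_def)
    \<comment> \<open>A positive definite \<open>U\<close> meets \<open>V\<close> only in 0, so it
      is no larger than a complement of \<open>V\<close> in \<open>T\<close>.\<close>
    fix y assume "y \<in> ?P"
    then obtain U where U: "y = dim U" "subspace U" "U \<subseteq> T" "\<And>v. v \<in> U \<Longrightarrow> v \<noteq> 0 \<Longrightarrow> B v v > 0"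
      by force
    have "v = 0" if "v \<in> V" "v \<in> U" for v
      using that U(4)[of v] V(3)[of v] by fastforce
    then have "V \<inter> U = {0}"
      using subspace_0[OF V(1)] subspace_0[OF U(2)] by blast
    then have "dim {x + y |x y. x \<in> V \<and> y \<in> U} = dim V + dim U"
      using dim_sums_Int[OF V(1) U(2)] by simp
    moreover have "{x + y |x y. x \<in> V \<and> y \<in> U} \<subseteq> T"
      using V(2) U(3) T by (auto simp: subspace_add subset_iff)
    then have "dim {x + y |x y. x \<in> V \<and> y \<in> U} \<le> dim T" by (rule dim_subset)
    ultimately show "y \<le> dim W" using dimS ST U by simp
  qed
  then show ?thesis using dimS ST Vmax by simp
qed

section \<open>Rotation by a right angle\<close>

text \<open>Multiplication by \<open>i\<close>. The number \<open>rot x \<bullet> y\<close> is the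
  determinant of \<open>x\<close> and \<open>y\<close>, which is how area enters.\<close>

definition rot :: "real^2 \<Rightarrow> real^2"
  where "rot x = vector [- (x $ 2), x $ 1]"

lemma rot_nth [simp]: "rot x $ 1 = - (x $ 2)" "rot x $ 2 = x $ 1"
  by (simp_all add: rot_def)

lemma inner_2: "x \<bullet> y = x $ 1 * y $ 1 + x $ 2 * y $ 2" for x y :: "real^2"
  by (simp add: inner_vec_def sum_2)

lemma rot_add [simp]: "rot (x + y) = rot x + rot y"
  and rot_diff [simp]: "rot (x - y) = rot x - rot y"
  and rot_scaleR [simp]: "rot (c *\<^sub>R x) = c *\<^sub>R rot x"
  and rot_minus [simp]: "rot (- x) = - rot x"
  and rot_0 [simp]: "rot 0 = 0"
  and rot_rot [simp]: "rot (rot x) = - x"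
  by (simp_all add: vec_eq_iff forall_2)

lemma inner_rot_rot [simp]: "rot x \<bullet> rot y = x \<bullet> y"
  and inner_rot_self [simp]: "rot x \<bullet> x = 0" "x \<bullet> rot x = 0"
  and inner_rot_right: "x \<bullet> rot y = - (rot x \<bullet> y)"
  by (simp_all add: inner_2 algebra_simps)

lemma norm_rot [simp]: "norm (rot x) = norm x"
  by (simp add: norm_eq_sqrt_inner)

lemma rot_eq_0_iff [simp]: "rot x = 0 \<longleftrightarrow> x = 0"
  by (metis norm_rot norm_eq_zero)

text \<open>Pythagoras in the orthogonal frame \<open>x\<close>, \<open>rot x\<close>, whose two
  vectors have equal length.\<close>

lemma inner_sq_add_rot_inner_sq: "(x \<bullet> y)\<^sup>2 + (rot x \<bullet> y)\<^sup>2 = (norm x)\<^sup>2 * (norm y)\<^sup>2"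
  by (simp add: power2_norm_eq_inner inner_2) algebra

section \<open>First and second variation of perimeter and area\<close>

definition edge :: "(real^2)^'n \<Rightarrow> nat \<Rightarrow> real^2"
  where "edge p k = vertex p (Suc k) - vertex p k"

text \<open>At a vanishing edge the value is 0, since \<open>sgn 0 = 0\<close>; such an edge drops
  out of \<open>perimeter_deriv\<close>.\<close>

definition edge_dir :: "(real^2)^'n \<Rightarrow> nat \<Rightarrow> real^2"
  where "edge_dir p k = sgn (edge p k)"

text \<open>The polarisation of area, normalised so that \<open>area_form p p = 2 * area p\<close>.
  Thus \<open>area_form p\<close> is the differential of area at \<open>p\<close>, and
  \<open>area_form\<close> itself its constant second derivative.\<close>

definition area_form :: "(real^2)^'n \<Rightarrow> (real^2)^'n \<Rightarrow> real"
  where "area_form v w = (\<Sum>k<CARD('n).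
    rot (vertex v k) \<bullet> vertex w (Suc k) + rot (vertex w k) \<bullet> vertex v (Suc k)) / 2"

definition perimeter_deriv :: "(real^2)^'n \<Rightarrow> (real^2)^'n \<Rightarrow> real"
  where "perimeter_deriv p v = (\<Sum>k<CARD('n). edge_dir p k \<bullet> edge v k)"

text \<open>The second derivative of the norm at a nonzero \<open>e\<close> sees only the components
  perpendicular to \<open>e\<close>, and divides their product by \<open>norm e\<close>.\<close>

definition perimeter_hessian :: "(real^2)^'n \<Rightarrow> (real^2)^'n \<Rightarrow> (real^2)^'n \<Rightarrow> real"
  where "perimeter_hessian p v w = (\<Sum>k<CARD('n).
    (rot (edge_dir p k) \<bullet> edge v k) * (rot (edge_dir p k) \<bullet> edge w k) / norm (edge p k))"

definition rot_tuple :: "(real^2)^'n \<Rightarrow> (real^2)^'n"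
  where "rot_tuple p = (\<chi> i. rot (p $ i))"

lemma vertex_add [simp]: "vertex (p + q) k = vertex p k + vertex q k"
  and vertex_diff [simp]: "vertex (p - q) k = vertex p k - vertex q k"
  and vertex_scaleR [simp]: "vertex (c *\<^sub>R p) k = c *\<^sub>R vertex p k"
  and vertex_minus [simp]: "vertex (- p) k = - vertex p k"
  and vertex_0 [simp]: "vertex 0 k = 0"
  and vertex_rot_tuple [simp]: "vertex (rot_tuple p) k = rot (vertex p k)"
  and vertex_const [simp]: "vertex (\<chi> i. b) k = b"
  by (simp_all add: vertex_def rot_tuple_def)

lemma edge_add [simp]: "edge (p + q) k = edge p k + edge q k"
  and edge_diff [simp]: "edge (p - q) k = edge p k - edge q k"
  and edge_scaleR [simp]: "edge (c *\<^sub>R p) k = c *\<^sub>R edge p k"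
  and edge_minus [simp]: "edge (- p) k = - edge p k"
  and edge_rot_tuple [simp]: "edge (rot_tuple p) k = rot (edge p k)"
  and edge_const [simp]: "edge (\<chi> i. b) k = 0"
  by (simp_all add: edge_def algebra_simps)

section \<open>Cyclic indexing of vertices and edges\<close>

lemma vertex_periodic: "vertex (p :: (real^2)^'n) (k + CARD('n)) = vertex p k"
  by (simp add: vertex_def)

lemma edge_periodic: "edge (p :: (real^2)^'n) (k + CARD('n)) = edge p k"
  using vertex_periodic[of p "Suc k"] by (simp add: edge_def vertex_periodic)

lemma edge_dir_periodic: "edge_dir (p :: (real^2)^'n) (k + CARD('n)) = edge_dir p k"
  by (simp add: edge_dir_def edge_periodic)

lemma sum_periodic_shift:
  fixes f :: "nat \<Rightarrow> 'a::ab_group_add"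
  assumes "\<And>k. f (k + n) = f k"
  shows "(\<Sum>k<n. f (Suc k)) = (\<Sum>k<n. f k)"
proof -
  have "(\<Sum>k<n. f (Suc k) - f k) = f n - f 0"
    by (rule sum_lessThan_telescope)
  also have "\<dots> = 0" using assms[of 0] by simp
  finally show ?thesis by (simp add: sum_subtractf)
qed

lemma periodic_nat_add_mult:
  fixes f :: "nat \<Rightarrow> 'a"
  assumes "\<And>k. f (k + n) = f k"
  shows "f (k + m * n) = f k"
proof (induction m)
  case (Suc m)
  then show ?case using assms[of "k + m * n"] by (simp add: algebra_simps)
qed simp

lemma edge_mod: "edge p (k mod CARD('n)) = edge (p :: (real^2)^'n) k"
  using periodic_nat_add_mult[of "edge p", OF edge_periodic, of "k mod CARD('n)" "k div CARD('n)"]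
  by simp

lemma ex_vertex: "\<exists>k<CARD('n). p $ i = vertex (p :: (real^2)^'n) k"
proof -
  have "i \<in> from_nat_into UNIV ` {..<CARD('n)}"
    using bij_betw_from_nat_into_finite[of "UNIV :: 'n set"] by (auto simp: bij_betw_def)
  then show ?thesis by (auto simp: vertex_def)
qed

text \<open>Inverting the enumeration of the index type turns a periodic sequence into a tuple; test
  vectors are prescribed in this way.\<close>

lemma ex_tuple_vertex:
  fixes f :: "nat \<Rightarrow> real^2"
  assumes "\<And>k. f (k + CARD('n)) = f k"
  obtains p :: "(real^2)^'n" where "\<And>k. vertex p k = f k"
proof
  fix k
  let ?g = "from_nat_into (UNIV :: 'n set)"
  have "inj_on ?g {..<CARD('n)}"
    using bij_betw_from_nat_into_finite[of "UNIV :: 'n set"] by (auto simp: bij_betw_def)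
  then have "the_inv_into {..<CARD('n)} ?g (?g (k mod CARD('n))) = k mod CARD('n)"
    by (rule the_inv_into_f_f) simp
  moreover have "f (k mod CARD('n)) = f k"
    using periodic_nat_add_mult[of f, OF assms, of "k mod CARD('n)" "k div CARD('n)"] by simp
  ultimately show "vertex (\<chi> i. f (the_inv_into {..<CARD('n)} ?g i)) k = f k"
    by (simp add: vertex_def)
qed

text \<open>Coefficients numbered by \<open>k\<close> will belong to the vertex \<open>Suc k\<close>
  shared by edges \<open>k\<close> and \<open>Suc k\<close>. Going back one index cyclically is a
  shift by \<open>CARD('n) - 1\<close>.\<close>

lemma ex_tuple_vertex_Suc:
  fixes f :: "nat \<Rightarrow> real^2"
  assumes f: "\<And>k. f (k + CARD('n)) = f k"
  obtains p :: "(real^2)^'n" where "\<And>k. vertex p (Suc k) = f k"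
proof -
  have "f (k + CARD('n) + (CARD('n) - 1)) = f (k + (CARD('n) - 1))" for k
    using f[of "k + (CARD('n) - 1)"] by (simp only: ac_simps)
  then obtain p :: "(real^2)^'n" where p: "\<And>k. vertex p k = f (k + (CARD('n) - 1))"
    using ex_tuple_vertex[of "\<lambda>k. f (k + (CARD('n) - 1))", where 'n = 'n] by blast
  have "Suc k + (CARD('n) - 1) = k + CARD('n)" for k by simp
  then show thesis using that[of p] by (metis p f)
qed

section \<open>Algebra of the forms and summation by parts\<close>

lemma perimeter_eq: "perimeter p = (\<Sum>k<CARD('n). norm (edge p k))"
  for p :: "(real^2)^'n"
  by (simp add: perimeter_def edge_def dist_norm norm_minus_commute)

lemma area_eq: "area p = area_form p p / 2"
proof -
  have "area_form p p = (\<Sum>k<CARD('a). rot (vertex p k) \<bullet> vertex p (Suc k))"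
    by (simp add: area_form_def sum.distrib[symmetric] mult_2[symmetric] sum_distrib_left[symmetric])
  then show ?thesis
    by (simp add: area_def inner_2 mult.commute)
qed

lemma area_form_add: "area_form (u + v) w = area_form u w + area_form v w"
  "area_form w (u + v) = area_form w u + area_form w v"
  by (simp_all add: area_form_def inner_add_left inner_add_right sum.distrib add_divide_distrib)

lemma area_form_scaleR: "area_form (c *\<^sub>R v) w = c * area_form v w"
  "area_form w (c *\<^sub>R v) = c * area_form w v"
  by (simp_all add: area_form_def sum_distrib_left algebra_simps)

lemma area_form_diff: "area_form (u - v) w = area_form u w - area_form v w"
  "area_form w (u - v) = area_form w u - area_form w v"
  by (simp_all add: area_form_def inner_diff_left inner_diff_right sum.distrib sum_subtractf
      diff_divide_distrib add_divide_distrib)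

lemma area_form_commute: "area_form v w = area_form w v"
  by (simp add: area_form_def add.commute)

lemma bilinear_area_form: "bilinear area_form"
  by (simp add: bilinear_def linear_iff area_form_add area_form_scaleR)

lemma perimeter_deriv_add: "perimeter_deriv p (v + w) = perimeter_deriv p v + perimeter_deriv p w"
  by (simp add: perimeter_deriv_def inner_add_right sum.distrib)

lemma perimeter_deriv_scaleR: "perimeter_deriv p (c *\<^sub>R v) = c * perimeter_deriv p v"
  by (simp add: perimeter_deriv_def sum_distrib_left)

lemma bilinear_perimeter_hessian: "bilinear (perimeter_hessian p)"
  by (simp add: bilinear_def linear_iff perimeter_hessian_def inner_add_right algebra_simps
      sum.distrib sum_distrib_left add_divide_distrib)

lemma perimeter_hessian_commute: "perimeter_hessian p v w = perimeter_hessian p w v"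
  by (simp add: perimeter_hessian_def mult.commute)

text \<open>A cyclic shift of the second sum collects all terms at the vertex \<open>Suc k\<close>
  of \<open>w\<close>. Its coefficient involves the chord from vertex \<open>k\<close> to vertex
  \<open>k + 2\<close> of \<open>v\<close>, which is the sum of two consecutive edges.\<close>

lemma area_form_eq_edges:
  "area_form v w = (\<Sum>k<CARD('n). - rot (edge v k + edge v (Suc k)) \<bullet> vertex w (Suc k)) / 2"
  for v w :: "(real^2)^'n"
proof -
  have "(\<Sum>k<CARD('n). rot (vertex w (Suc k)) \<bullet> vertex v (Suc (Suc k))) =
      (\<Sum>k<CARD('n). rot (vertex w k) \<bullet> vertex v (Suc k))"
    using sum_periodic_shift[of "\<lambda>k. rot (vertex w k) \<bullet> vertex v (Suc k)" "CARD('n)"]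
      vertex_periodic[of w] vertex_periodic[of v "Suc k" for k] by simp
  then have "area_form v w = (\<Sum>k<CARD('n). rot (vertex v k) \<bullet> vertex w (Suc k) +
      rot (vertex w (Suc k)) \<bullet> vertex v (Suc (Suc k))) / 2"
    by (simp add: area_form_def sum.distrib)
  also have "\<dots> = (\<Sum>k<CARD('n). - rot (edge v k + edge v (Suc k)) \<bullet> vertex w (Suc k)) / 2"
    by (simp add: edge_def inner_2 algebra_simps)
  finally show ?thesis .
qed

text \<open>In this shape the area term can be added summand by summand to the output of
  \<open>sum_inner_edge\<close>.\<close>

lemma mult_area_form_eq_edges:
  "c * area_form v w =
    - (\<Sum>k<CARD('n). ((c / 2) *\<^sub>R rot (edge v k + edge v (Suc k))) \<bullet> vertex w (Suc k))"
  for v w :: "(real^2)^'n"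
  unfolding area_form_eq_edges inner_scaleR_left sum_distrib_left[symmetric] inner_minus_left sum_negf
  by simp

text \<open>Summation by parts; periodicity cancels the boundary terms.\<close>

lemma sum_inner_edge:
  fixes g :: "nat \<Rightarrow> real^2" and v :: "(real^2)^'n"
  assumes "\<And>k. g (k + CARD('n)) = g k"
  shows "(\<Sum>k<CARD('n). g k \<bullet> edge v k) = (\<Sum>k<CARD('n). (g k - g (Suc k)) \<bullet> vertex v (Suc k))"
proof -
  have "(\<Sum>k<CARD('n). g (Suc k) \<bullet> vertex v (Suc k)) = (\<Sum>k<CARD('n). g k \<bullet> vertex v k)"
    by (rule sum_periodic_shift) (simp add: assms vertex_periodic)
  then show ?thesis
    by (simp add: edge_def inner_diff_left inner_diff_right sum_subtractf)
qed

lemma area_form_const [simp]: "area_form (\<chi> i. b) w = 0"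
  by (simp add: area_form_eq_edges)

text \<open>The infinitesimal form of the invariance of \<open>area_form\<close> under rotating both
  arguments.\<close>

lemma area_form_rot_tuple: "area_form (rot_tuple v) w = - area_form v (rot_tuple w)"
  by (simp add: area_form_def inner_rot_right inner_commute sum_negf[symmetric]
      sum.distrib algebra_simps minus_divide_left)

lemma area_form_rot_tuple_self [simp]: "area_form p (rot_tuple p) = 0"
  using area_form_rot_tuple[of p p] area_form_commute[of p "rot_tuple p"] by simp

text \<open>Testing with the tuple whose vertices are the coefficients themselves gives a vanishing
  sum of squares. This converts an identity in all variations into an equation at each
  vertex.\<close>

lemma sum_inner_eq_0_imp:
  fixes g :: "nat \<Rightarrow> real^2"
  assumes g: "\<And>k. g (k + CARD('n)) = g k"
    and "\<And>v :: (real^2)^'n. (\<Sum>k<CARD('n). g k \<bullet> vertex v (Suc k)) = 0"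
  shows "g k = 0"
proof -
  obtain v :: "(real^2)^'n" where v: "\<And>k. vertex v (Suc k) = g k"
    using ex_tuple_vertex_Suc[of g, where 'n = 'n] g by blast
  have "(\<Sum>k<CARD('n). g k \<bullet> g k) = 0"
    using assms(2)[of v] by (simp add: v)
  then have "g k = 0" if "k < CARD('n)" for k
    using that by (simp add: sum_nonneg_eq_0_iff)
  then have "g (k mod CARD('n)) = 0" by simp
  then show ?thesis
    using periodic_nat_add_mult[of g, OF g, of "k mod CARD('n)" "k div CARD('n)"] by simp
qed

lemma sgn_inner_self: "sgn x \<bullet> x = norm (x::'a::real_inner)"
  by (cases "x = 0") (simp_all add: sgn_div_norm power2_norm_eq_inner[symmetric] power2_eq_square)

lemma inner_edge_dir [simp]: "edge_dir p k \<bullet> edge p k = norm (edge p k)"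
  by (simp add: edge_dir_def sgn_inner_self)

lemma rot_edge_dir_inner_edge [simp]: "rot (edge_dir p k) \<bullet> edge p k = 0"
  by (simp add: edge_dir_def sgn_div_norm)

lemma rot_edge_dir_inner_rot_edge [simp]: "rot (edge_dir p k) \<bullet> rot (edge p k) = norm (edge p k)"
  by simp

lemma norm_edge_dir: "edge p k \<noteq> 0 \<Longrightarrow> norm (edge_dir p k) = 1"
  by (simp add: edge_dir_def norm_sgn)

lemma norm_scaleR_edge_dir: "norm (edge p k) *\<^sub>R edge_dir p k = edge p k"
  by (cases "edge p k = 0") (simp_all add: edge_dir_def sgn_div_norm)

lemma perimeter_deriv_self: "perimeter_deriv p p = perimeter p"
  by (simp add: perimeter_deriv_def perimeter_eq)

section \<open>Critical points\<close>

lemma orbit_directions_eq: "orbit_directions p = {(\<chi> i. b) + c *\<^sub>R rot_tuple p |b c. True}"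
  by (auto simp: orbit_directions_def rot_tuple_def rot_def vec_eq_iff)

lemma subspace_orbit_directions: "subspace (orbit_directions p)"
proof (rule subspaceI)
  show "0 \<in> orbit_directions p"
    unfolding orbit_directions_eq by (auto intro!: exI[of _ 0] simp: vec_eq_iff)
next
  fix x y assume "x \<in> orbit_directions p" "y \<in> orbit_directions p"
  then obtain b c b' c' where "x = (\<chi> i. b) + c *\<^sub>R rot_tuple p" "y = (\<chi> i. b') + c' *\<^sub>R rot_tuple p"
    by (auto simp: orbit_directions_eq)
  then have "x + y = (\<chi> i. b + b') + (c + c') *\<^sub>R rot_tuple p"
    by (simp add: vec_eq_iff algebra_simps)
  then show "x + y \<in> orbit_directions p"
    unfolding orbit_directions_eq by blast
next
  fix r x assume "x \<in> orbit_directions p"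
  then obtain b c where "x = (\<chi> i. b) + c *\<^sub>R rot_tuple p"
    by (auto simp: orbit_directions_eq)
  then have "r *\<^sub>R x = (\<chi> i. r *\<^sub>R b) + (r * c) *\<^sub>R rot_tuple p"
    by (simp add: vec_eq_iff algebra_simps)
  then show "r *\<^sub>R x \<in> orbit_directions p"
    unfolding orbit_directions_eq by blast
qed

lemma orbit_horizontal_decomp:
  obtains y z where "y \<in> orbit_directions p" "z \<in> horizontal_space p" "x = y + z"
proof -
  have *: "span (orbit_directions p) = orbit_directions p"
    using subspace_orbit_directions by (simp add: span_eq_iff)
  show thesis
    by (rule orthogonal_subspace_decomp_exists[of "orbit_directions p" x], rule that)
      (auto simp: * orthogonal_comp_def orthogonal_commute)
qed

lemma horizontal_space_inter_orbit:
  "v \<in> horizontal_space p \<Longrightarrow> v \<in> orbit_directions p \<Longrightarrow> v = 0"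
  using orthogonal_self by (auto simp: orthogonal_comp_def)

text \<open>Isometries preserve area, so its differential vanishes along the orbit.\<close>

lemma area_form_orbit_direction:
  assumes "w \<in> orbit_directions p"
  shows "area_form p w = 0"
  using assms by (auto simp: orbit_directions_eq area_form_add area_form_scaleR
      area_form_commute[of p "\<chi> i. b" for b])

lemma linear_real_eq_inner:
  fixes f :: "'a::euclidean_space \<Rightarrow> real"
  assumes "linear f"
  obtains z where "\<And>x. f x = z \<bullet> x"
  using adjoint_works[OF assms, of _ 1] by (metis inner_commute inner_real_def mult.right_neutral)

section \<open>Clarke derivatives and gradients of area and perimeter\<close>

lemma clarke_derivative_le:
  assumes ev: "\<And>y t. t > 0 \<Longrightarrow> (f (y + t *\<^sub>R v) - f y) / t \<le> \<phi> y t"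
    and lim: "((\<lambda>(y, t). \<phi> y t) \<longlongrightarrow> L) (nhds x \<times>\<^sub>F at_right 0)"
  shows "clarke_derivative f x v \<le> ereal L"
proof -
  have "eventually (\<lambda>(y, t). t > 0) (nhds x \<times>\<^sub>F at_right (0::real))"
    unfolding eventually_prod_filter
    by (rule exI[of _ "\<lambda>_. True"], rule exI[of _ "\<lambda>t. t > 0"])
      (auto simp: eventually_at_right_less)
  then have "clarke_derivative f x v \<le>
      Limsup (nhds x \<times>\<^sub>F at_right 0) (\<lambda>(y, t). ereal (\<phi> y t))"
    unfolding clarke_derivative_def
    by (intro Limsup_mono) (auto elim!: eventually_mono simp: ev)
  also have "\<dots> = ereal L"
  proof (rule lim_imp_Limsup)
    show "((\<lambda>(y, t). ereal (\<phi> y t)) \<longlongrightarrow> ereal L) (nhds x \<times>\<^sub>F at_right 0)"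
      using lim by (simp add: case_prod_unfold)
  qed (simp add: prod_filter_eq_bot)
  finally show ?thesis .
qed

lemma clarke_derivative_ge:
  assumes ev: "\<And>y t. t > 0 \<Longrightarrow> (f (y + t *\<^sub>R v) - f y) / t \<ge> \<phi> y t"
    and lim: "((\<lambda>(y, t). \<phi> y t) \<longlongrightarrow> L) (nhds x \<times>\<^sub>F at_right 0)"
  shows "clarke_derivative f x v \<ge> ereal L"
proof -
  have "eventually (\<lambda>(y, t). t > 0) (nhds x \<times>\<^sub>F at_right (0::real))"
    unfolding eventually_prod_filter
    by (rule exI[of _ "\<lambda>_. True"], rule exI[of _ "\<lambda>t. t > 0"])
      (auto simp: eventually_at_right_less)
  then have "clarke_derivative f x v \<ge>
      Limsup (nhds x \<times>\<^sub>F at_right 0) (\<lambda>(y, t). ereal (\<phi> y t))"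
    unfolding clarke_derivative_def
    by (intro Limsup_mono) (auto elim!: eventually_mono simp: ev)
  also have "Limsup (nhds x \<times>\<^sub>F at_right 0) (\<lambda>(y, t). ereal (\<phi> y t)) = ereal L"
  proof (rule lim_imp_Limsup)
    show "((\<lambda>(y, t). ereal (\<phi> y t)) \<longlongrightarrow> ereal L) (nhds x \<times>\<^sub>F at_right 0)"
      using lim by (simp add: case_prod_unfold)
  qed (simp add: prod_filter_eq_bot)
  finally show ?thesis .
qed

lemma tendsto_fst_nhds_times: "(fst \<longlongrightarrow> x) (nhds x \<times>\<^sub>F at_right (0::real))"
  by (rule filterlim_fst)

lemma tendsto_snd_times_at_right: "(snd \<longlongrightarrow> 0) (nhds x \<times>\<^sub>F at_right (0::real))"
  by (rule filterlim_mono[OF filterlim_snd _ order_refl]) (simp add: at_within_def)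

lemma bounded_linear_edge: "bounded_linear (\<lambda>p. edge p k)"
  by (rule linear_conv_bounded_linear[THEN iffD1]) (simp add: linear_iff)

lemma bounded_bilinear_area_form: "bounded_bilinear area_form"
  using bilinear_area_form by (simp add: bilinear_conv_bounded_bilinear)

text \<open>Area is quadratic, so its difference quotient is
  \<open>area_form y v + t * area v\<close>, which is jointly continuous in \<open>y\<close> and
  \<open>t\<close>.\<close>

lemma clarke_derivative_area: "clarke_derivative area p v = ereal (area_form p v)"
proof -
  have quot: "(area (y + t *\<^sub>R v) - area y) / t = area_form y v + t * area v" if "t > 0" for y t
    using that by (simp add: area_eq area_form_add area_form_scaleR area_form_commute[of v y]
        field_simps)
  have lim: "((\<lambda>(y, t). area_form y v + t * area v) \<longlongrightarrow> area_form p v) (nhds p \<times>\<^sub>F at_right 0)"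
    unfolding case_prod_unfold
    using tendsto_add[OF bounded_bilinear.tendsto[OF bounded_bilinear_area_form
          tendsto_fst_nhds_times tendsto_const] tendsto_mult[OF tendsto_snd_times_at_right tendsto_const]]
    by simp
  show ?thesis
    by (intro antisym clarke_derivative_le[OF _ lim] clarke_derivative_ge[OF _ lim]) (simp_all add: quot)
qed

lemma sgn_inner_le: "sgn x \<bullet> y \<le> norm (y::'a::real_inner)"
  using Cauchy_Schwarz_ineq2[of "sgn x" y] mult_left_le_one_le[of "norm y" "norm (sgn x)"]
  by (simp add: norm_sgn split: if_splits)

text \<open>By convexity of the norm, a difference quotient lies between the subgradients at its two
  end points; this is the upper half, and \<open>norm_quotient_ge_sgn\<close> the lower.\<close>

lemma norm_quotient_le_sgn:
  fixes e d :: "'a::real_inner"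
  assumes "t > 0"
  shows "(norm (e + t *\<^sub>R d) - norm e) / t \<le> sgn (e + t *\<^sub>R d) \<bullet> d"
  using sgn_inner_le[of "e + t *\<^sub>R d" e] sgn_inner_self[of "e + t *\<^sub>R d"] assms
  by (simp add: inner_add_right field_simps)

lemma norm_quotient_ge_sgn:
  fixes e d :: "'a::real_inner"
  assumes "t > 0"
  shows "sgn e \<bullet> d \<le> (norm (e + t *\<^sub>R d) - norm e) / t"
  using sgn_inner_le[of e "e + t *\<^sub>R d"] sgn_inner_self[of e] assms
  by (simp add: inner_add_right field_simps)

lemma norm_quotient_le_norm:
  fixes e d :: "'a::real_normed_vector"
  assumes "t > 0"
  shows "(norm (e + t *\<^sub>R d) - norm e) / t \<le> norm d"
  using norm_triangle_ineq[of e "t *\<^sub>R d"] assms by (simp add: field_simps)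

lemma perimeter_quotient:
  "(perimeter (y + t *\<^sub>R v) - perimeter y) / t =
    (\<Sum>k<CARD('n). (norm (edge y k + t *\<^sub>R edge v k) - norm (edge y k)) / t)"
  for y v :: "(real^2)^'n"
  by (simp add: perimeter_eq sum_subtractf[symmetric] sum_divide_distrib)

text \<open>Edge by edge: where the edge of \<open>p\<close> is nonzero, \<open>sgn\<close> is
  continuous and the convexity bound converges; where it vanishes, only the Lipschitz bound by the
  norm of the edge of \<open>v\<close> remains.\<close>

lemma clarke_derivative_perimeter_le:
  fixes p v :: "(real^2)^'n"
  shows "clarke_derivative perimeter p v \<le>
    ereal (perimeter_deriv p v + (\<Sum>k<CARD('n). if edge p k = 0 then norm (edge v k) else 0))"
proof -
  define \<phi> where "\<phi> k y t = (if edge p k = 0 then norm (edge v k)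
    else sgn (edge y k + t *\<^sub>R edge v k) \<bullet> edge v k)" for k t and y :: "(real^2)^'n"
  have "clarke_derivative perimeter p v \<le> ereal (\<Sum>k<CARD('n).
      if edge p k = 0 then norm (edge v k) else edge_dir p k \<bullet> edge v k)"
  proof (rule clarke_derivative_le)
    show "(perimeter (y + t *\<^sub>R v) - perimeter y) / t \<le> (\<Sum>k<CARD('n). \<phi> k y t)" if "t > 0" for y t
      unfolding perimeter_quotient \<phi>_def using that
      by (intro sum_mono) (auto simp: norm_quotient_le_norm norm_quotient_le_sgn)
    have "((\<lambda>x. \<phi> k (fst x) (snd x)) \<longlongrightarrow>
        (if edge p k = 0 then norm (edge v k) else edge_dir p k \<bullet> edge v k))
        (nhds p \<times>\<^sub>F at_right 0)" for k
    proof (cases "edge p k = 0")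
      case False
      have "((\<lambda>x. edge (fst x) k + snd x *\<^sub>R edge v k) \<longlongrightarrow> edge p k + 0 *\<^sub>R edge v k)
          (nhds p \<times>\<^sub>F at_right 0)"
        by (intro tendsto_add tendsto_scaleR tendsto_const tendsto_snd_times_at_right
            bounded_linear.tendsto[OF bounded_linear_edge] tendsto_fst_nhds_times)
      then have "((\<lambda>x. sgn (edge (fst x) k + snd x *\<^sub>R edge v k) \<bullet> edge v k) \<longlongrightarrow>
          sgn (edge p k) \<bullet> edge v k) (nhds p \<times>\<^sub>F at_right 0)"
        using False by (intro tendsto_inner tendsto_sgn tendsto_const) auto
      then show ?thesis using False by (simp add: \<phi>_def edge_dir_def)
    qed (simp add: \<phi>_def)
    then show "((\<lambda>(y, t). \<Sum>k<CARD('n). \<phi> k y t) \<longlongrightarrow> (\<Sum>k<CARD('n).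
        if edge p k = 0 then norm (edge v k) else edge_dir p k \<bullet> edge v k)) (nhds p \<times>\<^sub>F at_right 0)"
      unfolding case_prod_unfold by (intro tendsto_sum)
  qed
  also have "(\<Sum>k<CARD('n). if edge p k = 0 then norm (edge v k) else edge_dir p k \<bullet> edge v k) =
      perimeter_deriv p v + (\<Sum>k<CARD('n). if edge p k = 0 then norm (edge v k) else 0)"
    unfolding perimeter_deriv_def sum.distrib[symmetric]
    by (intro sum.cong) (auto simp: edge_dir_def)
  finally show ?thesis .
qed

lemma clarke_derivative_perimeter_ge:
  fixes p v :: "(real^2)^'n"
  assumes "\<And>k. edge p k \<noteq> 0"
  shows "ereal (perimeter_deriv p v) \<le> clarke_derivative perimeter p v"
proof (rule clarke_derivative_ge)
  show "(\<Sum>k<CARD('n). sgn (edge y k) \<bullet> edge v k) \<le> (perimeter (y + t *\<^sub>R v) - perimeter y) / t"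
    if "t > 0" for y t
    unfolding perimeter_quotient using that by (intro sum_mono norm_quotient_ge_sgn)
  show "((\<lambda>(y, t::real). \<Sum>k<CARD('n). sgn (edge y k) \<bullet> edge v k) \<longlongrightarrow> perimeter_deriv p v)
      (nhds p \<times>\<^sub>F at_right 0)"
    unfolding case_prod_unfold perimeter_deriv_def edge_dir_def using assms
    by (intro tendsto_sum tendsto_inner tendsto_sgn tendsto_const
        bounded_linear.tendsto[OF bounded_linear_edge] tendsto_fst_nhds_times)
qed

lemma clarke_gradient_area:
  "\<eta> \<in> clarke_gradient area p \<longleftrightarrow> (\<forall>v. \<eta> \<bullet> v = area_form p v)"
proof
  assume "\<eta> \<in> clarke_gradient area p"
  then have *: "\<eta> \<bullet> v \<le> area_form p v" for v
    by (simp add: clarke_gradient_def clarke_derivative_area)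
  show "\<forall>v. \<eta> \<bullet> v = area_form p v"
  proof
    fix v
    show "\<eta> \<bullet> v = area_form p v"
      using *[of v] *[of "- v"] area_form_scaleR(2)[of p "-1" v] by simp
  qed
qed (simp add: clarke_gradient_def clarke_derivative_area)

lemma clarke_gradient_perimeter_le:
  fixes p v :: "(real^2)^'n"
  assumes "\<xi> \<in> clarke_gradient perimeter p"
  shows "\<xi> \<bullet> v \<le> perimeter_deriv p v + (\<Sum>k<CARD('n). if edge p k = 0 then norm (edge v k) else 0)"
proof -
  have "ereal (\<xi> \<bullet> v) \<le> clarke_derivative perimeter p v"
    using assms by (simp add: clarke_gradient_def)
  from order_trans[OF this clarke_derivative_perimeter_le] show ?thesis by simp
qed

text \<open>If \<open>v\<close> leaves the vanishing edges at zero, the Lipschitz remainder is 0 for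
  \<open>v\<close> and for \<open>- v\<close>, and the two inequalities meet. This covers
  \<open>p\<close> itself and the orbit directions even when some edges vanish.\<close>

lemma clarke_gradient_perimeter_eq:
  fixes p v :: "(real^2)^'n"
  assumes "\<xi> \<in> clarke_gradient perimeter p" and "\<And>k. edge p k = 0 \<Longrightarrow> edge v k = 0"
  shows "\<xi> \<bullet> v = perimeter_deriv p v"
proof -
  have "(\<Sum>k<CARD('n). if edge p k = 0 then norm (edge w k) else 0) = 0" if "w \<in> {v, - v}" for w
    using assms(2) that by (intro sum.neutral) auto
  from this[of v] this[of "- v"] show ?thesis
    using clarke_gradient_perimeter_le[OF assms(1), of v]
      clarke_gradient_perimeter_le[OF assms(1), of "-v"] perimeter_deriv_scaleR[of p "-1" v]
    by simp
qed

section \<open>The multiplier rule and the exclusion of vanishing edges\<close>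

text \<open>The smooth Lagrange condition, posed on all variations rather than only on horizontal
  ones.\<close>

definition stationary :: "(real^2)^'n \<Rightarrow> real \<Rightarrow> bool"
  where "stationary p \<mu> \<longleftrightarrow>
    (\<forall>k. edge p k \<noteq> 0) \<and> (\<forall>v. perimeter_deriv p v = \<mu> * area_form p v)"

lemma ex_nonzero_edge:
  assumes "area (p :: (real^2)^'n) \<noteq> 0"
  shows "\<exists>k. edge p k \<noteq> 0"
proof (rule ccontr)
  assume "\<not> ?thesis"
  then have "area_form p p = 0" by (simp add: area_form_eq_edges)
  then show False using assms by (simp add: area_eq)
qed

lemma perimeter_pos:
  assumes "area (p :: (real^2)^'n) \<noteq> 0"
  shows "perimeter p > 0"
proof -
  obtain k where "edge p k \<noteq> 0"
    using ex_nonzero_edge[OF assms] by blast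
  then have "edge p (k mod CARD('n)) \<noteq> 0"
    by (simp add: edge_mod)
  then show ?thesis
    unfolding perimeter_eq
    by (intro sum_pos2[of _ "k mod CARD('n)"]) auto
qed

text \<open>If edge \<open>m\<close> is nonzero but edge \<open>m + 1\<close> vanishes, moving their common vertex shows that
  \<open>u + (\<mu>/2) rot e\<close> has norm at most 1, where \<open>e\<close> is edge \<open>m\<close> and \<open>u\<close> its direction; but the
  summands are orthogonal and \<open>u\<close> has norm 1.\<close>

lemma nonzero_edge_Suc:
  fixes p \<xi> :: "(real^2)^'n"
  assumes \<xi>: "\<xi> \<in> clarke_gradient perimeter p"
    and eq: "\<And>v. \<xi> \<bullet> v = \<mu> * area_form p v" and "\<mu> \<noteq> 0"
    and em: "edge p m \<noteq> 0"
  shows "edge p (Suc m) \<noteq> 0"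
proof
  assume es: "edge p (Suc m) = 0"
  \<comment> \<open>Minus the vector \<open>u + (\<mu>/2) rot e\<close>: for this displacement of
    the vertex, the gradient inequality becomes \<open>z \<bullet> z \<le> norm z\<close>.\<close>
  define z where "z = - ((\<mu> / 2) *\<^sub>R rot (edge p m)) - edge_dir p m"
  have mod_Suc_eq: "Suc k mod CARD('n) = Suc m mod CARD('n) \<longleftrightarrow> k mod CARD('n) = m mod CARD('n)" for k
    by (auto simp: mod_Suc)
  obtain v :: "(real^2)^'n" where
    v: "\<And>k. vertex v k = (if k mod CARD('n) = Suc m mod CARD('n) then z else 0)"
    using ex_tuple_vertex[of "\<lambda>k. if k mod CARD('n) = Suc m mod CARD('n) then z else 0",
        where 'n = 'n] by auto
  have bump: "(\<Sum>k<CARD('n). g k \<bullet> vertex v (Suc k)) = g m \<bullet> z"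
    if g: "\<And>k. g (k + CARD('n)) = g k" for g
  proof -
    have "(\<Sum>k<CARD('n). g k \<bullet> vertex v (Suc k)) =
        (\<Sum>k<CARD('n). if k = m mod CARD('n) then g k \<bullet> z else 0)"
      by (intro sum.cong) (auto simp: v mod_Suc_eq)
    also have "\<dots> = g (m mod CARD('n)) \<bullet> z" by simp
    also have "g (m mod CARD('n)) = g m"
      using periodic_nat_add_mult[of g, OF g, of "m mod CARD('n)" "m div CARD('n)"] by simp
    finally show ?thesis .
  qed
  have "perimeter_deriv p v = (edge_dir p m - edge_dir p (Suc m)) \<bullet> z"
    unfolding perimeter_deriv_def
    by (subst sum_inner_edge)
      (use edge_dir_periodic[of p "Suc k" for k] in \<open>auto simp: edge_dir_periodic intro!: bump\<close>)
  then have D: "perimeter_deriv p v = edge_dir p m \<bullet> z"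
    by (simp add: edge_dir_def es)
  have "area_form p v = (\<Sum>k<CARD('n). (- rot (edge p k + edge p (Suc k))) \<bullet> vertex v (Suc k)) / 2"
    by (rule area_form_eq_edges)
  also have "\<dots> = - rot (edge p m + edge p (Suc m)) \<bullet> z / 2"
    by (subst bump) (use edge_periodic[of p "Suc k" for k] in \<open>auto simp: edge_periodic\<close>)
  finally have S: "area_form p v = - (rot (edge p m) \<bullet> z) / 2"
    by (simp add: es)
  \<comment> \<open>Only edges \<open>m\<close> and \<open>m + 1\<close> can move, and edge
    \<open>m\<close> is nonzero, so at most edge \<open>m + 1\<close> contributes a
    remainder.\<close>
  have "(\<Sum>k<CARD('n). if edge p k = 0 then norm (edge v k) else 0) \<le>
      (\<Sum>k<CARD('n). if k = Suc m mod CARD('n) then norm z else 0)"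
  proof (rule sum_mono)
    fix k assume "k \<in> {..<CARD('n)}"
    then have "Suc k mod CARD('n) \<noteq> Suc m mod CARD('n)" if "edge p k = 0"
      using that em edge_mod[of p m] edge_mod[of p k] unfolding mod_Suc_eq by auto
    then show "(if edge p k = 0 then norm (edge v k) else 0) \<le>
        (if k = Suc m mod CARD('n) then norm z else 0)"
      using \<open>k \<in> _\<close> by (auto simp: edge_def[of v] v)
  qed
  also have "\<dots> = norm z" by simp
  finally have "\<mu> * area_form p v \<le> edge_dir p m \<bullet> z + norm z"
    using clarke_gradient_perimeter_le[OF \<xi>, of v] by (simp add: D eq)
  then have "z \<bullet> z \<le> norm z"
    by (subst (asm) S, subst z_def) (simp add: inner_diff_left)
  then have "norm z * norm z \<le> norm z * 1"
    by (simp add: power2_norm_eq_inner[symmetric] power2_eq_square)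
  then have "norm z \<le> 1"
    by (cases "norm z = 0") (auto simp: mult_le_cancel_left)
  then have "(norm z)\<^sup>2 \<le> 1" by (simp add: power_le_one)
  moreover have "(norm z)\<^sup>2 = (\<mu> / 2)\<^sup>2 * (norm (edge p m))\<^sup>2 + 1"
  proof -
    have "rot (edge p m) \<bullet> edge_dir p m = 0"
      by (simp add: edge_dir_def sgn_div_norm)
    moreover have "edge_dir p m \<bullet> edge_dir p m = 1"
      using norm_edge_dir[OF em] by (simp add: norm_eq_1)
    ultimately have "z \<bullet> z = (\<mu> / 2)\<^sup>2 * (edge p m \<bullet> edge p m) + 1"
      by (simp add: z_def inner_diff_left inner_diff_right inner_commute[of "edge_dir p m" "rot (edge p m)"]
          power2_eq_square)
    then show ?thesis
      by (simp add: power2_norm_eq_inner)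
  qed
  moreover have "(\<mu> / 2)\<^sup>2 * (norm (edge p m))\<^sup>2 > 0"
    using em \<open>\<mu> \<noteq> 0\<close> by simp
  ultimately show False by linarith
qed

text \<open>The generalized gradient \<open>\<xi>\<close> of perimeter kills the horizontal kernel
  of the area differential by criticality, and the orbit by invariance, hence the whole kernel. So
  it is a multiple of that differential, and pairing with \<open>p\<close> determines the factor.
  Nonvanishing then spreads from one edge to all others.\<close>

lemma critical_imp_stationary:
  fixes p :: "(real^2)^'n::finite"
  assumes area: "area p \<noteq> 0"
    and crit: "clarke_critical_on_level perimeter area p"
  shows "stationary p (perimeter p / (2 * area p))"
proof -
  define \<mu> where "\<mu> = perimeter p / (2 * area p)"
  obtain \<xi> \<eta> where \<xi>: "\<xi> \<in> clarke_gradient perimeter p" and \<eta>: "\<eta> \<in> clarke_gradient area p"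
    and H: "\<And>v. v \<in> horizontal_space p \<Longrightarrow> \<eta> \<bullet> v = 0 \<Longrightarrow> \<xi> \<bullet> v = 0"
    using crit unfolding clarke_critical_on_level_def by blast
  have \<eta>S: "\<eta> \<bullet> v = area_form p v" for v
    using \<eta> clarke_gradient_area by blast
  have \<xi>p: "\<xi> \<bullet> p = perimeter p"
    using clarke_gradient_perimeter_eq[OF \<xi>, of p] by (simp add: perimeter_deriv_self)
  have orbit: "\<xi> \<bullet> w = 0" if w_orbit: "w \<in> orbit_directions p" for w
  proof -
    obtain b c where w: "w = (\<chi> i. b) + c *\<^sub>R rot_tuple p"
      using w_orbit unfolding orbit_directions_eq by blast
    have "\<xi> \<bullet> w = perimeter_deriv p w"
      by (rule clarke_gradient_perimeter_eq[OF \<xi>]) (simp add: w)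
    also have "\<dots> = 0"
      unfolding perimeter_deriv_def
      by (intro sum.neutral) (simp add: w inner_rot_right)
    finally show ?thesis .
  qed
  have ker: "\<xi> \<bullet> v = 0" if "area_form p v = 0" for v
  proof -
    obtain y z where yz: "y \<in> orbit_directions p" "z \<in> horizontal_space p" "v = y + z"
      by (rule orbit_horizontal_decomp)
    then have "area_form p z = 0"
      using that area_form_orbit_direction[of y p] by (simp add: area_form_add)
    then show ?thesis
      using yz H[of z] orbit[of y] by (simp add: \<eta>S inner_add_right)
  qed
  have eq: "\<xi> \<bullet> v = \<mu> * area_form p v" for v
  proof -
    \<comment> \<open>The multiple of \<open>p\<close> is chosen by
      \<open>area_form p p = 2 * area p\<close> so that the difference lies in the kernel of the
      area differential.\<close>
    have "\<xi> \<bullet> (v - (area_form p v / (2 * area p)) *\<^sub>R p) = 0"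
      by (rule ker) (use area in \<open>simp add: area_form_diff area_form_scaleR area_eq\<close>)
    then show ?thesis by (simp add: inner_diff_right \<xi>p \<mu>_def)
  qed
  have "\<mu> \<noteq> 0" using area perimeter_pos[OF area] by (simp add: \<mu>_def)
  note step = nonzero_edge_Suc[OF \<xi> eq this]
  obtain k0 where k0: "edge p k0 \<noteq> 0" using ex_nonzero_edge[OF area] by blast
  have "edge p (k0 + j) \<noteq> 0" for j
    by (induction j) (use k0 step in auto)
  moreover have "\<exists>j. edge p k = edge p (k0 + j)" for k
  proof
    \<comment> \<open>The propagation only runs forwards, so \<open>k\<close> is replaced by a
      congruent index that is at least \<open>k0\<close>.\<close>
    have "k + k0 * CARD('n) \<ge> k0" by (simp add: trans_le_add2)
    then have "k0 + (k + k0 * CARD('n) - k0) = k + k0 * CARD('n)" by simp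
    then show "edge p k = edge p (k0 + (k + k0 * CARD('n) - k0))"
      using periodic_nat_add_mult[of "edge p", OF edge_periodic] by simp
  qed
  ultimately have nz: "edge p k \<noteq> 0" for k by metis
  have "perimeter_deriv p v = \<mu> * area_form p v" for v
    using eq[of v] clarke_gradient_perimeter_eq[OF \<xi>, of v] nz by simp
  then show ?thesis using nz by (simp add: stationary_def \<mu>_def)
qed

text \<open>With \<mu> nonzero, the two differentials have the same kernel, so the roles of function
  and constraint can be exchanged.\<close>

lemma stationary_imp_critical:
  fixes p :: "(real^2)^'n::finite"
  assumes "stationary p \<mu>" "\<mu> \<noteq> 0"
  shows "clarke_critical_on_level area perimeter p"
proof -
  obtain \<xi> where \<xi>: "\<And>v. perimeter_deriv p v = \<xi> \<bullet> v"
    by (rule linear_real_eq_inner[of "perimeter_deriv p"])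
      (auto simp: linear_iff perimeter_deriv_add perimeter_deriv_scaleR)
  obtain \<eta> where \<eta>: "\<And>v. area_form p v = \<eta> \<bullet> v"
    by (rule linear_real_eq_inner[of "area_form p"])
      (auto simp: linear_iff area_form_add area_form_scaleR)
  have "\<xi> \<in> clarke_gradient perimeter p"
    using clarke_derivative_perimeter_ge[of p] assms(1)
    by (simp add: clarke_gradient_def \<xi>[symmetric] stationary_def)
  moreover have "\<eta> \<in> clarke_gradient area p"
    by (simp add: clarke_gradient_area \<eta>)
  moreover have "\<xi> \<bullet> v = \<mu> * (\<eta> \<bullet> v)" for v
    using assms(1) by (simp add: stationary_def \<xi> \<eta>)
  ultimately show ?thesis
    unfolding clarke_critical_on_level_def using assms(2)
    by (intro bexI[of _ \<eta>] bexI[of _ \<xi>]) auto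
qed

text \<open>The differential of perimeter is homogeneous of degree 0 in \<open>p\<close> and that of
  area of degree 1, so the multiplier scales inversely.\<close>

lemma stationary_scaleR:
  assumes "stationary p \<mu>" "s > 0"
  shows "stationary (s *\<^sub>R p) (\<mu> / s)"
proof -
  have "edge_dir (s *\<^sub>R p) k = edge_dir p k" for k
    using assms(2) by (simp add: edge_dir_def sgn_scaleR)
  then have "perimeter_deriv (s *\<^sub>R p) v = perimeter_deriv p v" for v
    by (simp add: perimeter_deriv_def)
  then show ?thesis
    using assms by (auto simp: stationary_def area_form_scaleR)
qed

section \<open>Nondegeneracy of critical points\<close>

text \<open>At a stationary tuple with nonzero multiplier this one space is tangent to both level
  sets, since the differentials are proportional.\<close>

definition level_tangent :: "(real^2)^'n::finite \<Rightarrow> ((real^2)^'n) set"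
  where "level_tangent p = {v \<in> horizontal_space p. area_form p v = 0}"

definition lagrangian_hessian :: "(real^2)^'n \<Rightarrow> real \<Rightarrow> (real^2)^'n \<Rightarrow> (real^2)^'n \<Rightarrow> real"
  where "lagrangian_hessian p \<mu> v w = perimeter_hessian p v w - \<mu> * area_form v w"

text \<open>After summation by parts stationarity becomes an equation at the vertex
  \<open>Suc k\<close>, written with one adjacent edge on each side.\<close>

lemma stationary_vertex:
  fixes p :: "(real^2)^'n"
  assumes "stationary p \<mu>"
  shows "edge_dir p k + (\<mu> / 2) *\<^sub>R rot (edge p k) =
    edge_dir p (Suc k) - (\<mu> / 2) *\<^sub>R rot (edge p (Suc k))"
proof -
  define g where "g k = edge_dir p k - edge_dir p (Suc k) +
    (\<mu> / 2) *\<^sub>R rot (edge p k + edge p (Suc k))" for k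
  have "g k = 0"
  proof (rule sum_inner_eq_0_imp[where 'n = 'n])
    show "g (k + CARD('n)) = g k" for k
      using edge_periodic[of p "Suc k"] edge_dir_periodic[of p "Suc k"]
      by (simp add: g_def edge_periodic edge_dir_periodic)
    fix v :: "(real^2)^'n"
    have "(\<Sum>k<CARD('n). g k \<bullet> vertex v (Suc k)) = perimeter_deriv p v - \<mu> * area_form p v"
      unfolding perimeter_deriv_def mult_area_form_eq_edges g_def
      by (subst sum_inner_edge)
        (simp_all only: edge_dir_periodic inner_add_left sum.distrib diff_minus_eq_add)
    then show "(\<Sum>k<CARD('n). g k \<bullet> vertex v (Suc k)) = 0"
      using assms by (simp add: stationary_def)
  qed
  then show ?thesis by (simp add: g_def algebra_simps)
qed

lemma unit_rot_decomp:
  assumes "norm u = 1"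
  shows "d = (u \<bullet> d) *\<^sub>R u + (rot u \<bullet> d) *\<^sub>R rot u"
proof -
  have u: "u $ 1 * u $ 1 + u $ 2 * u $ 2 = 1"
    using assms by (simp add: norm_eq_1 inner_2)
  have "d $ 1 = (u $ 1 * u $ 1 + u $ 2 * u $ 2) * d $ 1" "d $ 2 = (u $ 1 * u $ 1 + u $ 2 * u $ 2) * d $ 2"
    by (simp_all add: u)
  then show ?thesis
    by (simp add: vec_eq_iff forall_2 inner_2 algebra_simps)
qed

lemma kernel_lagrangian_hessian:
  fixes p v :: "(real^2)^'n"
  assumes st: "stationary p \<mu>" and "\<mu> \<noteq> 0"
    and ker: "\<And>w. lagrangian_hessian p \<mu> v w = 0"
  shows "v \<in> orbit_directions p"
proof -
  define u where "u = edge_dir p"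
  define d where "d = edge v"
  define l where "l = norm (edge p 0)"
  define \<tau> where "\<tau> = \<mu> * l / 2"
  define \<alpha> where "\<alpha> k = u k \<bullet> d k" for k
  define \<beta> where "\<beta> k = rot (u k) \<bullet> d k" for k
  have u1: "norm (u k) = 1" for k
    using st norm_edge_dir[of p k] by (simp add: u_def stationary_def)
  then have uu: "u k \<bullet> u k = 1" for k
    by (simp add: norm_eq_1)
  have len_Suc: "norm (edge p (Suc k)) = norm (edge p k)" for k
  proof -
    have e: "edge p j = norm (edge p j) *\<^sub>R u j" for j
      by (simp add: u_def norm_scaleR_edge_dir)
    have "(u j + c *\<^sub>R rot (edge p j)) \<bullet> (u j + c *\<^sub>R rot (edge p j)) = 1 + c\<^sup>2 * (norm (edge p j))\<^sup>2"
      for j c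
      by (subst (1 2) e) (simp add: inner_add_left inner_add_right uu power2_eq_square)
    \<comment> \<open>Both sides of the vertex equation are sums of orthogonal vectors; comparing
      their squared norms shows that adjacent edges have equal length.\<close>
    from this[of k "\<mu> / 2"] this[of "Suc k" "- (\<mu> / 2)"]
    have "(norm (edge p (Suc k)))\<^sup>2 = (norm (edge p k))\<^sup>2"
      using stationary_vertex[OF st, of k] \<open>\<mu> \<noteq> 0\<close> by (simp add: u_def)
    then show ?thesis by simp
  qed
  have len: "norm (edge p k) = l" for k
    by (induction k) (simp_all add: l_def len_Suc)
  have l0: "l > 0" using st by (simp add: l_def stationary_def)
  have \<tau>0: "\<tau> \<noteq> 0" using l0 \<open>\<mu> \<noteq> 0\<close> by (simp add: \<tau>_def)
  have edge: "edge p k = l *\<^sub>R u k" for k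
    using norm_scaleR_edge_dir[of p k] by (simp add: len u_def)
  \<comment> \<open>The common value of the two sides of the vertex equation, once every edge is
    written as \<open>l\<close> times its direction.\<close>
  define m where "m k = u k + \<tau> *\<^sub>R rot (u k)" for k
  have m': "m k = u (Suc k) - \<tau> *\<^sub>R rot (u (Suc k))" for k
    using stationary_vertex[OF st, of k] unfolding edge by (simp add: m_def u_def \<tau>_def)
  \<comment> \<open>The coefficient of the vertex \<open>Suc k\<close> of \<open>w\<close> in the
    kernel equation after summation by parts.\<close>
  define g where "g k = (\<beta> k / l) *\<^sub>R rot (u k) - (\<beta> (Suc k) / l) *\<^sub>R rot (u (Suc k)) +
    (\<mu> / 2) *\<^sub>R rot (d k + d (Suc k))" for k
  have per: "u (k + CARD('n)) = u k" "d (k + CARD('n)) = d k" "\<beta> (k + CARD('n)) = \<beta> k" for k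
    by (simp_all add: u_def d_def \<beta>_def edge_periodic edge_dir_periodic)
  have g0: "g k = 0" for k
  proof (rule sum_inner_eq_0_imp[where 'n = 'n])
    show "g (k + CARD('n)) = g k" for k
      using per[of "Suc k"] by (simp add: g_def per)
    fix w :: "(real^2)^'n"
    have "perimeter_hessian p v w = (\<Sum>k<CARD('n). ((\<beta> k / l) *\<^sub>R rot (u k)) \<bullet> edge w k)"
      by (simp add: perimeter_hessian_def len \<beta>_def u_def d_def)
    also have "\<dots> = (\<Sum>k<CARD('n). ((\<beta> k / l) *\<^sub>R rot (u k) -
        (\<beta> (Suc k) / l) *\<^sub>R rot (u (Suc k))) \<bullet> vertex w (Suc k))"
      by (rule sum_inner_edge) (simp add: per)
    finally have "(\<Sum>k<CARD('n). g k \<bullet> vertex w (Suc k)) = lagrangian_hessian p \<mu> v w"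
      unfolding lagrangian_hessian_def mult_area_form_eq_edges g_def d_def
      by (simp only: inner_add_left sum.distrib diff_minus_eq_add)
    then show "(\<Sum>k<CARD('n). g k \<bullet> vertex w (Suc k)) = 0"
      using ker by simp
  qed
  text \<open>Tangential and normal parts of the equation at vertex \<open>k + 1\<close>, read off against the vector
    \<open>m k\<close> and its rotation because \<open>m k\<close> is symmetric in the two edges.\<close>
  have \<alpha>_Suc: "\<alpha> (Suc k) = \<alpha> k" and \<beta>_Suc: "(1 + \<tau>\<^sup>2) * (\<beta> (Suc k) - \<beta> k) = \<tau> * (\<alpha> k + \<alpha> (Suc k))" for k
  proof -
    have i0: "rot (u k) \<bullet> m k = \<tau>" "rot (u k) \<bullet> rot (m k) = 1"
      by (simp_all add: m_def inner_add_right inner_diff_right uu)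
    have i1: "rot (u (Suc k)) \<bullet> m k = - \<tau>" "rot (u (Suc k)) \<bullet> rot (m k) = 1"
      by (simp_all add: m' inner_add_right inner_diff_right uu)
    have i2: "rot (d k) \<bullet> m k = - \<beta> k + \<tau> * \<alpha> k" "rot (d k) \<bullet> rot (m k) = \<alpha> k + \<tau> * \<beta> k"
      by (simp_all add: m_def inner_add_right \<alpha>_def \<beta>_def inner_2 algebra_simps)
    have i3: "rot (d (Suc k)) \<bullet> m k = - \<beta> (Suc k) - \<tau> * \<alpha> (Suc k)"
      "rot (d (Suc k)) \<bullet> rot (m k) = \<alpha> (Suc k) - \<tau> * \<beta> (Suc k)"
      by (simp_all add: m' inner_diff_right \<alpha>_def \<beta>_def inner_2 algebra_simps)
    \<comment> \<open>All terms in \<beta> cancel here, which leaves \<open>\<tau> * \<tau>\<close>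
      times the difference of consecutive \<alpha>.\<close>
    have "l * (g k \<bullet> m k) = \<beta> k * \<tau> + \<beta> (Suc k) * \<tau> +
        \<tau> * (- \<beta> k + \<tau> * \<alpha> k + (- \<beta> (Suc k) - \<tau> * \<alpha> (Suc k)))"
      using l0 by (simp add: g_def inner_add_left inner_diff_left i0 i1 i2 i3 \<tau>_def field_simps)
    then have "\<tau> * \<tau> * (\<alpha> k - \<alpha> (Suc k)) = 0"
      by (simp add: g0 algebra_simps) auto
    then show "\<alpha> (Suc k) = \<alpha> k" using \<tau>0 by simp
    have "l * (g k \<bullet> rot (m k)) = \<beta> k - \<beta> (Suc k) +
        \<tau> * (\<alpha> k + \<tau> * \<beta> k + (\<alpha> (Suc k) - \<tau> * \<beta> (Suc k)))"
      unfolding g_def inner_add_left inner_diff_left rot_add inner_scaleR_left i0 i1 i2 i3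
      using l0 by (simp add: \<tau>_def field_simps)
    then show "(1 + \<tau>\<^sup>2) * (\<beta> (Suc k) - \<beta> k) = \<tau> * (\<alpha> k + \<alpha> (Suc k))"
      by (simp add: g0 algebra_simps power2_eq_square)
  qed
  have \<alpha>: "\<alpha> k = \<alpha> 0" for k by (induction k) (simp_all add: \<alpha>_Suc)
  have \<beta>_step: "(1 + \<tau>\<^sup>2) * (\<beta> (Suc k) - \<beta> k) = \<tau> * (\<alpha> 0 + \<alpha> 0)" for k
    using \<beta>_Suc[of k] by (simp only: \<alpha>[of k] \<alpha>[of "Suc k"])
  \<comment> \<open>The increments of \<beta> are all equal and sum to zero around the closed
    polygon.\<close>
  have "(\<Sum>k<CARD('n). (1 + \<tau>\<^sup>2) * (\<beta> (Suc k) - \<beta> k)) = (1 + \<tau>\<^sup>2) * (\<beta> CARD('n) - \<beta> 0)"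
    by (simp add: sum_distrib_left[symmetric] sum_lessThan_telescope)
  also have "\<beta> CARD('n) = \<beta> 0" using per(3)[of 0] by simp
  finally have "(\<Sum>k<CARD('n). \<tau> * (\<alpha> 0 + \<alpha> 0)) = 0"
    unfolding \<beta>_step by simp
  then have \<alpha>0: "\<alpha> k = 0" for k using \<tau>0 \<alpha>[of k] by simp
  have "1 + \<tau>\<^sup>2 > 0" by (simp add: add_pos_nonneg)
  then have "\<beta> (Suc k) = \<beta> k" for k using \<beta>_Suc[of k] by (simp add: \<alpha>0)
  then have \<beta>: "\<beta> k = \<beta> 0" for k by (induction k) simp_all
  \<comment> \<open>Subtracting the infinitesimal rotation with angular speed
    \<open>\<beta> 0 / l\<close> leaves a variation that changes no edge, which is a
    translation.\<close>
  define w where "w = v - (\<beta> 0 / l) *\<^sub>R rot_tuple p"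
  have "edge w k = 0" for k
  proof -
    have "d k = \<beta> 0 *\<^sub>R rot (u k)"
      using unit_rot_decomp[OF u1[of k], of "d k"] \<alpha>0[of k] \<beta>[of k] by (simp add: \<alpha>_def \<beta>_def)
    then show ?thesis using l0 edge by (simp add: w_def d_def)
  qed
  then have "vertex w (Suc k) = vertex w k" for k by (simp add: edge_def)
  then have "vertex w k = vertex w 0" for k by (induction k) simp_all
  then have "w = (\<chi> i. vertex w 0)"
    using ex_vertex[of w] by (simp add: vec_eq_iff) metis
  then have "v = (\<chi> i. vertex w 0) + (\<beta> 0 / l) *\<^sub>R rot_tuple p"
    by (simp add: w_def algebra_simps)
  then show ?thesis unfolding orbit_directions_eq by blast
qed

lemma bilinear_lagrangian_hessian: "bilinear (lagrangian_hessian p \<mu>)"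
  using bilinear_perimeter_hessian[of p]
  by (simp add: bilinear_def linear_iff lagrangian_hessian_def area_form_add area_form_scaleR
      algebra_simps)

lemma lagrangian_hessian_commute: "lagrangian_hessian p \<mu> v w = lagrangian_hessian p \<mu> w v"
  by (simp add: lagrangian_hessian_def perimeter_hessian_commute[of p v] area_form_commute[of v])

text \<open>Translations change no edge. For the rotation part, the perimeter term reduces to
  \<open>perimeter_deriv p (rot_tuple v)\<close>, and stationarity makes it cancel the area
  term.\<close>

lemma lagrangian_hessian_orbit_direction:
  fixes p v :: "(real^2)^'n"
  assumes st: "stationary p \<mu>" and w: "w \<in> orbit_directions p"
  shows "lagrangian_hessian p \<mu> v w = 0"
proof -
  obtain b c where w: "w = (\<chi> i. b) + c *\<^sub>R rot_tuple p"
    using w unfolding orbit_directions_eq by blast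
  have "perimeter_hessian p v w = c * (\<Sum>k<CARD('n). rot (edge_dir p k) \<bullet> edge v k)"
    using st by (simp add: perimeter_hessian_def w sum_distrib_left stationary_def mult.commute
        rot_edge_dir_inner_rot_edge del: inner_rot_rot)
  also have "(\<Sum>k<CARD('n). rot (edge_dir p k) \<bullet> edge v k) = - perimeter_deriv p (rot_tuple v)"
    by (simp add: perimeter_deriv_def inner_rot_right sum_negf)
  also have "perimeter_deriv p (rot_tuple v) = \<mu> * area_form p (rot_tuple v)"
    using st by (simp add: stationary_def)
  also have "area_form p (rot_tuple v) = - area_form v (rot_tuple p)"
    using area_form_rot_tuple[of p v] area_form_commute[of v] by simp
  finally show ?thesis
    by (simp add: lagrangian_hessian_def w area_form_add area_form_scaleR
        area_form_commute[of v "\<chi> i. b"])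
qed

text \<open>Together with the orbit directions and \<open>p\<close> itself the tangent space spans
  everything. Both extra parts pair to zero with \<open>v\<close>, so a kernel vector on the tangent
  space is one on all tuples; it is then both horizontal and along the orbit.\<close>

lemma lagrangian_hessian_nondegenerate:
  fixes p :: "(real^2)^'n::finite"
  assumes st: "stationary p \<mu>" and "\<mu> \<noteq> 0" and area: "area p \<noteq> 0"
    and v: "v \<in> level_tangent p"
    and ker: "\<And>w. w \<in> level_tangent p \<Longrightarrow> lagrangian_hessian p \<mu> v w = 0"
  shows "v = 0"
proof -
  note B = bilinear_lagrangian_hessian[of p \<mu>]
  have self: "lagrangian_hessian p \<mu> v p = 0"
    using v by (simp add: lagrangian_hessian_def perimeter_hessian_def level_tangent_def
        area_form_commute[of v])
  have "lagrangian_hessian p \<mu> v w = 0" for w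
  proof -
    define w' where "w' = w - (area_form p w / (2 * area p)) *\<^sub>R p"
    obtain y z where yz: "y \<in> orbit_directions p" "z \<in> horizontal_space p" "w' = y + z"
      by (rule orbit_horizontal_decomp)
    have "area_form p w' = 0"
      using area by (simp add: w'_def area_form_diff area_form_scaleR area_eq)
    then have "area_form p z = 0"
      using area_form_orbit_direction[OF yz(1)] by (simp add: yz(3) area_form_add)
    then have "lagrangian_hessian p \<mu> v z = 0"
      using yz(2) by (intro ker) (simp add: level_tangent_def)
    then have "lagrangian_hessian p \<mu> v w' = 0"
      using lagrangian_hessian_orbit_direction[OF st yz(1)] by (simp add: yz(3) bilinear_radd[OF B])
    then show ?thesis
      by (simp add: w'_def bilinear_rsub[OF B] bilinear_rmul[OF B] self)
  qed
  then have "v \<in> orbit_directions p"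
    by (rule kernel_lagrangian_hessian[OF st \<open>\<mu> \<noteq> 0\<close>])
  then show "v = 0"
    using v horizontal_space_inter_orbit[of v p] by (simp add: level_tangent_def)
qed

lemma subspace_level_tangent: "subspace (level_tangent p)"
  using subspace_orthogonal_comp[of "orbit_directions p"]
  by (simp add: level_tangent_def subspace_def area_form_add area_form_scaleR
      area_form_commute[of p 0] area_form_def[of 0])

text \<open>Four independent vectors are excluded: two translations, the rotation, which is not
  constant because some edge is nonzero, and the area gradient, which is orthogonal to the orbit and
  nonzero because its product with \<open>p\<close> is \<open>2 * area p\<close>.\<close>

lemma dim_level_tangent:
  fixes p :: "(real^2)^'n::finite"
  assumes area: "area p \<noteq> 0"
  shows "dim (level_tangent p) = 2 * CARD('n) - 4"
proof -
  define C where "C = range (\<lambda>b. (\<chi> i. b) :: (real^2)^'n)"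
  have linC: "linear (\<lambda>b. (\<chi> i. b) :: (real^2)^'n)"
    by (simp add: linear_iff vec_eq_iff)
  have subC: "subspace C"
    unfolding C_def by (rule linear_subspace_image[OF linC]) simp
  have "dim C = dim (UNIV :: (real^2) set)"
    unfolding C_def by (rule dim_image_eq[OF linC]) (simp add: inj_on_def vec_eq_iff)
  then have dimC: "dim C = 2" by simp
  have "rot_tuple p \<notin> C"
  proof
    assume "rot_tuple p \<in> C"
    then obtain b where b: "rot_tuple p = (\<chi> i. b)" by (auto simp: C_def)
    have "rot (edge p k) = 0" for k
      by (simp add: edge_rot_tuple[symmetric] b del: edge_rot_tuple)
    then show False using ex_nonzero_edge[OF area] by simp
  qed
  then have "rot_tuple p \<notin> span C" using subC by (metis span_eq_iff)
  then have "dim (insert (rot_tuple p) C) = 3"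
    by (simp add: dim_insert dimC)
  moreover have "span (insert (rot_tuple p) C) = orbit_directions p"
  proof
    show "span (insert (rot_tuple p) C) \<subseteq> orbit_directions p"
    proof (rule span_minimal[OF _ subspace_orbit_directions])
      have "rot_tuple p = (\<chi> i. 0) + 1 *\<^sub>R rot_tuple p" by (simp add: vec_eq_iff)
      moreover have "(\<chi> i. b) = (\<chi> i. b) + 0 *\<^sub>R rot_tuple p" for b by simp
      ultimately show "insert (rot_tuple p) C \<subseteq> orbit_directions p"
        unfolding C_def orbit_directions_eq by blast
    qed
    show "orbit_directions p \<subseteq> span (insert (rot_tuple p) C)"
      unfolding orbit_directions_eq C_def
      by (auto intro!: span_add span_scale intro: span_base)
  qed
  ultimately have dimO: "dim (orbit_directions p) = 3"
    by (metis dim_span)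
  obtain z where z: "\<And>v. area_form p v = z \<bullet> v"
    by (rule linear_real_eq_inner[of "area_form p"])
      (auto simp: linear_iff area_form_add area_form_scaleR)
  have "z \<notin> orbit_directions p"
  proof
    assume "z \<in> orbit_directions p"
    then have "z \<bullet> z = 0" using area_form_orbit_direction[of z p] by (simp add: z)
    then have "area_form p p = 0" by (simp add: z)
    then show False using area by (simp add: area_eq)
  qed
  then have "z \<notin> span (orbit_directions p)"
    using subspace_orbit_directions by (metis span_eq_iff)
  then have "dim (span (insert z (orbit_directions p))) = 4"
    by (simp add: dim_insert dimO)
  moreover have "level_tangent p =
      {y \<in> UNIV. \<forall>x\<in>span (insert z (orbit_directions p)). orthogonal x y}" (is "_ = ?R")
  proof
    show "?R \<subseteq> level_tangent p"
      by (auto simp: level_tangent_def orthogonal_comp_def z orthogonal_def intro: span_base)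
    show "level_tangent p \<subseteq> ?R"
    proof clarsimp
      fix y x assume y: "y \<in> level_tangent p" and x: "x \<in> span (insert z (orbit_directions p))"
      have "orthogonal y x"
        by (rule orthogonal_to_span[OF x])
          (use y in \<open>auto simp: level_tangent_def orthogonal_comp_def z orthogonal_def inner_commute\<close>)
      then show "orthogonal x y" by (simp add: orthogonal_commute)
    qed
  qed
  ultimately have "dim (level_tangent p) + 4 = DIM((real^2)^'n)"
    using dim_subspace_orthogonal_to_vectors[of "span (insert z (orbit_directions p))" UNIV] by simp
  then show ?thesis by simp
qed

section \<open>Hessians and indices on level sets\<close>

lemma has_real_derivative_norm_compose:
  fixes c :: "real \<Rightarrow> 'a::real_inner"
  assumes "(c has_vector_derivative c') (at t)" "c t \<noteq> 0"
  shows "((\<lambda>t. norm (c t)) has_real_derivative sgn (c t) \<bullet> c') (at t)"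
proof -
  have "((\<lambda>t. norm (c t)) has_derivative (\<lambda>y. (y *\<^sub>R c') \<bullet> sgn (c t))) (at t)"
    by (rule has_derivative_compose[OF assms(1)[unfolded has_vector_derivative_def]
          has_derivative_norm[OF assms(2)]])
  then show ?thesis
    unfolding has_field_derivative_def
    by (rule has_derivative_eq_rhs) (simp add: fun_eq_iff inner_commute)
qed

text \<open>The quotient rule for \<open>(c t \<bullet> c' t) / norm (c t)\<close>: the tangential
  part of the velocity cancels, and by Pythagoras the perpendicular part remains.\<close>

lemma has_real_derivative_sgn_inner:
  fixes c c' :: "real \<Rightarrow> real^2"
  assumes c: "(c has_vector_derivative c' t) (at t)" and c': "(c' has_vector_derivative c'') (at t)"
    and nz: "c t \<noteq> 0"
  shows "((\<lambda>t. sgn (c t) \<bullet> c' t) has_real_derivative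
    (rot (sgn (c t)) \<bullet> c' t)\<^sup>2 / norm (c t) + sgn (c t) \<bullet> c'') (at t)"
proof -
  let ?s = "sgn (c t)"
  have inner: "((\<lambda>t. c t \<bullet> c' t) has_real_derivative c t \<bullet> c'' + c' t \<bullet> c' t) (at t)"
    using bounded_bilinear.has_vector_derivative[OF bounded_bilinear_inner c c']
    by (simp add: has_real_derivative_iff_has_vector_derivative)
  have "((\<lambda>t. (c t \<bullet> c' t) / norm (c t)) has_real_derivative
      ((c t \<bullet> c'' + c' t \<bullet> c' t) * norm (c t) - (c t \<bullet> c' t) * (?s \<bullet> c' t)) / (norm (c t) * norm (c t))) (at t)"
    using nz by (intro DERIV_divide inner has_real_derivative_norm_compose[OF c]) auto
  also have "(\<lambda>t. (c t \<bullet> c' t) / norm (c t)) = (\<lambda>t. sgn (c t) \<bullet> c' t)"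
    by (simp add: sgn_div_norm divide_inverse mult.commute)
  also have "((c t \<bullet> c'' + c' t \<bullet> c' t) * norm (c t) - (c t \<bullet> c' t) * (?s \<bullet> c' t)) / (norm (c t) * norm (c t))
      = (c' t \<bullet> c' t - (?s \<bullet> c' t)\<^sup>2) / norm (c t) + ?s \<bullet> c''"
  proof -
    have "c t \<bullet> x = norm (c t) * (?s \<bullet> x)" for x
      using nz by (simp add: sgn_div_norm)
    then show ?thesis using nz by (simp add: field_simps power2_eq_square)
  qed
  also have "c' t \<bullet> c' t - (?s \<bullet> c' t)\<^sup>2 = (rot ?s \<bullet> c' t)\<^sup>2"
    using inner_sq_add_rot_inner_sq[of ?s "c' t"] nz
    by (simp add: norm_sgn power2_norm_eq_inner)
  finally show ?thesis .
qed

lemma edge_has_vector_derivative: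
  assumes "(\<gamma> has_vector_derivative \<gamma>') (at t)"
  shows "((\<lambda>t. edge (\<gamma> t) k) has_vector_derivative edge \<gamma>' k) (at t)"
  by (rule bounded_linear.has_vector_derivative[OF bounded_linear_edge assms])

lemma perimeter_derivatives:
  fixes \<gamma> \<gamma>' \<gamma>'' :: "real \<Rightarrow> (real^2)^'n"
  assumes d1: "\<And>t. \<bar>t\<bar> < \<epsilon> \<Longrightarrow> (\<gamma> has_vector_derivative \<gamma>' t) (at t)"
    and d2: "\<And>t. \<bar>t\<bar> < \<epsilon> \<Longrightarrow> (\<gamma>' has_vector_derivative \<gamma>'' t) (at t)"
    and "\<epsilon> > 0" and nz: "\<And>k. edge (\<gamma> 0) k \<noteq> 0"
  shows "deriv (perimeter \<circ> \<gamma>) 0 = perimeter_deriv (\<gamma> 0) (\<gamma>' 0)"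
    and "deriv (deriv (perimeter \<circ> \<gamma>)) 0 =
      perimeter_hessian (\<gamma> 0) (\<gamma>' 0) (\<gamma>' 0) + perimeter_deriv (\<gamma> 0) (\<gamma>'' 0)"
proof -
  \<comment> \<open>The first derivative is needed on a neighbourhood of 0, as it is differentiated
    again; there continuity keeps the edges nonzero.\<close>
  have near: "\<forall>\<^sub>F t in nhds 0. \<bar>t\<bar> < \<epsilon>"
    using \<open>\<epsilon> > 0\<close> eventually_nhds_in_open[of "{-\<epsilon><..<\<epsilon>}" 0]
    by (auto elim!: eventually_mono)
  have "\<forall>\<^sub>F t in nhds 0. edge (\<gamma> t) k \<noteq> 0" for k
  proof -
    have "isCont (\<lambda>t. edge (\<gamma> t) k) 0"
      using edge_has_vector_derivative[OF d1[of 0]] \<open>\<epsilon> > 0\<close> has_vector_derivative_continuous by fastforce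
    then have "((\<lambda>t. edge (\<gamma> t) k) \<longlongrightarrow> edge (\<gamma> 0) k) (nhds 0)"
      unfolding isCont_def using tendsto_at_iff_tendsto_nhds[of "\<lambda>t. edge (\<gamma> t) k" 0] by blast
    then show ?thesis
      using nz tendsto_imp_eventually_ne by blast
  qed
  then have "\<forall>\<^sub>F t in nhds 0. \<forall>k\<in>{..<CARD('n)}. edge (\<gamma> t) k \<noteq> 0"
    by (intro eventually_ball_finite) auto
  then have "\<forall>\<^sub>F t in nhds 0. \<bar>t\<bar> < \<epsilon> \<and> (\<forall>k<CARD('n). edge (\<gamma> t) k \<noteq> 0)"
    using near by eventually_elim auto
  then have ev: "\<forall>\<^sub>F t in nhds 0. deriv (perimeter \<circ> \<gamma>) t =
      (\<Sum>k<CARD('n). sgn (edge (\<gamma> t) k) \<bullet> edge (\<gamma>' t) k)"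
  proof eventually_elim
    case (elim t)
    then have "((\<lambda>t. \<Sum>k<CARD('n). norm (edge (\<gamma> t) k)) has_real_derivative
        (\<Sum>k<CARD('n). sgn (edge (\<gamma> t) k) \<bullet> edge (\<gamma>' t) k)) (at t)"
      by (intro DERIV_sum has_real_derivative_norm_compose edge_has_vector_derivative d1) auto
    then show ?case
      by (intro DERIV_imp_deriv) (simp add: perimeter_eq o_def)
  qed
  from eventually_nhds_x_imp_x[OF this] show "deriv (perimeter \<circ> \<gamma>) 0 = perimeter_deriv (\<gamma> 0) (\<gamma>' 0)"
    by (simp add: perimeter_deriv_def edge_dir_def)
  have "((\<lambda>t. \<Sum>k<CARD('n). sgn (edge (\<gamma> t) k) \<bullet> edge (\<gamma>' t) k) has_real_derivative
      (\<Sum>k<CARD('n). (rot (sgn (edge (\<gamma> 0) k)) \<bullet> edge (\<gamma>' 0) k)\<^sup>2 / norm (edge (\<gamma> 0) k) +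
        sgn (edge (\<gamma> 0) k) \<bullet> edge (\<gamma>'' 0) k)) (at 0)"
    using nz \<open>\<epsilon> > 0\<close>
    by (intro DERIV_sum has_real_derivative_sgn_inner edge_has_vector_derivative d1 d2) auto
  from DERIV_imp_deriv[OF this]
  show "deriv (deriv (perimeter \<circ> \<gamma>)) 0 =
      perimeter_hessian (\<gamma> 0) (\<gamma>' 0) (\<gamma>' 0) + perimeter_deriv (\<gamma> 0) (\<gamma>'' 0)"
    by (subst deriv_cong_ev[OF ev refl])
      (simp add: perimeter_hessian_def perimeter_deriv_def edge_dir_def sum.distrib power2_eq_square)
qed

lemma area_derivatives:
  fixes \<gamma> \<gamma>' \<gamma>'' :: "real \<Rightarrow> (real^2)^'n"
  assumes d1: "\<And>t. \<bar>t\<bar> < \<epsilon> \<Longrightarrow> (\<gamma> has_vector_derivative \<gamma>' t) (at t)"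
    and d2: "\<And>t. \<bar>t\<bar> < \<epsilon> \<Longrightarrow> (\<gamma>' has_vector_derivative \<gamma>'' t) (at t)"
    and "\<epsilon> > 0"
  shows "deriv (area \<circ> \<gamma>) 0 = area_form (\<gamma> 0) (\<gamma>' 0)"
    and "deriv (deriv (area \<circ> \<gamma>)) 0 = area_form (\<gamma>' 0) (\<gamma>' 0) + area_form (\<gamma> 0) (\<gamma>'' 0)"
proof -
  have "deriv (area \<circ> \<gamma>) t = area_form (\<gamma> t) (\<gamma>' t)" if "\<bar>t\<bar> < \<epsilon>" for t
  proof -
    have "((\<lambda>t. area_form (\<gamma> t) (\<gamma> t)) has_real_derivative
        area_form (\<gamma> t) (\<gamma>' t) + area_form (\<gamma>' t) (\<gamma> t)) (at t)"
      using bounded_bilinear.has_vector_derivative[OF bounded_bilinear_area_form d1 d1] that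
      by (simp add: has_real_derivative_iff_has_vector_derivative)
    from DERIV_cdivide[OF this, of 2] show ?thesis
      by (intro DERIV_imp_deriv) (simp add: area_eq o_def area_form_commute[of "\<gamma>' t"])
  qed
  then have ev: "\<forall>\<^sub>F t in nhds 0. deriv (area \<circ> \<gamma>) t = area_form (\<gamma> t) (\<gamma>' t)"
    using \<open>\<epsilon> > 0\<close> eventually_nhds_in_open[of "{-\<epsilon><..<\<epsilon>}" 0]
    by (auto elim!: eventually_mono)
  from eventually_nhds_x_imp_x[OF this]
  show "deriv (area \<circ> \<gamma>) 0 = area_form (\<gamma> 0) (\<gamma>' 0)" .
  have "((\<lambda>t. area_form (\<gamma> t) (\<gamma>' t)) has_real_derivative
      area_form (\<gamma> 0) (\<gamma>'' 0) + area_form (\<gamma>' 0) (\<gamma>' 0)) (at 0)"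
    using bounded_bilinear.has_vector_derivative[OF bounded_bilinear_area_form d1 d2, of 0] \<open>\<epsilon> > 0\<close>
    by (simp add: has_real_derivative_iff_has_vector_derivative)
  from DERIV_imp_deriv[OF this]
  show "deriv (deriv (area \<circ> \<gamma>)) 0 = area_form (\<gamma>' 0) (\<gamma>' 0) + area_form (\<gamma> 0) (\<gamma>'' 0)"
    by (subst deriv_cong_ev[OF ev refl]) simp
qed

lemma level_curve_derivatives:
  assumes "level_curve g p v \<gamma>"
  shows "deriv (g \<circ> \<gamma>) 0 = 0" "deriv (deriv (g \<circ> \<gamma>)) 0 = 0"
proof -
  obtain \<epsilon> where "\<epsilon> > 0" and g: "\<And>t. t \<in> {-\<epsilon><..<\<epsilon>} \<Longrightarrow> g (\<gamma> t) = g p"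
    using assms unfolding level_curve_def by blast
  have "deriv (g \<circ> \<gamma>) t = 0" if "t \<in> {-\<epsilon><..<\<epsilon>}" for t
  proof -
    have "\<forall>\<^sub>F s in nhds t. (g \<circ> \<gamma>) s = g p"
      using that eventually_nhds_in_open[of "{-\<epsilon><..<\<epsilon>}" t] by (auto elim!: eventually_mono simp: g)
    then have "deriv (g \<circ> \<gamma>) t = deriv (\<lambda>_. g p) t" by (rule deriv_cong_ev) simp
    then show ?thesis by simp
  qed
  then have ev: "\<forall>\<^sub>F t in nhds 0. deriv (g \<circ> \<gamma>) t = 0"
    using \<open>\<epsilon> > 0\<close> eventually_nhds_in_open[of "{-\<epsilon><..<\<epsilon>}" 0] by (auto elim!: eventually_mono)
  from eventually_nhds_x_imp_x[OF this] show "deriv (g \<circ> \<gamma>) 0 = 0" .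
  show "deriv (deriv (g \<circ> \<gamma>)) 0 = 0"
    by (subst deriv_cong_ev[OF ev refl]) simp
qed

text \<open>The acceleration \<open>w\<close> enters both second derivatives only through the first
  differentials, so stationarity can eliminate it.\<close>

lemma level_curve_expansion:
  fixes p v :: "(real^2)^'n"
  assumes nz: "\<And>k. edge p k \<noteq> 0" and curve: "level_curve g p v \<gamma>"
  obtains w where
    "deriv (perimeter \<circ> \<gamma>) 0 = perimeter_deriv p v"
    "deriv (deriv (perimeter \<circ> \<gamma>)) 0 = perimeter_hessian p v v + perimeter_deriv p w"
    "deriv (area \<circ> \<gamma>) 0 = area_form p v"
    "deriv (deriv (area \<circ> \<gamma>)) 0 = area_form v v + area_form p w"
proof -
  obtain \<epsilon> \<gamma>' \<gamma>'' where "\<epsilon> > 0" and 0: "\<gamma> 0 = p" "\<gamma>' 0 = v"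
    and d: "\<And>t. t \<in> {-\<epsilon><..<\<epsilon>} \<Longrightarrow> (\<gamma> has_vector_derivative \<gamma>' t) (at t)"
      "\<And>t. t \<in> {-\<epsilon><..<\<epsilon>} \<Longrightarrow> (\<gamma>' has_vector_derivative \<gamma>'' t) (at t)"
    using curve unfolding level_curve_def by blast
  have d': "\<And>t. \<bar>t\<bar> < \<epsilon> \<Longrightarrow> (\<gamma> has_vector_derivative \<gamma>' t) (at t)"
      "\<And>t. \<bar>t\<bar> < \<epsilon> \<Longrightarrow> (\<gamma>' has_vector_derivative \<gamma>'' t) (at t)"
    by (rule d; simp add: abs_less_iff)+
  have "edge (\<gamma> 0) k \<noteq> 0" for k using nz by (simp add: 0)
  from perimeter_derivatives[OF d' \<open>\<epsilon> > 0\<close> this] area_derivatives[OF d' \<open>\<epsilon> > 0\<close>]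
  show thesis by (intro that[of "\<gamma>'' 0"]) (simp_all add: 0)
qed

text \<open>By homogeneity, rescaling the line \<open>p + t v\<close> puts it back on the level set, so no implicit
  function theorem is needed to realise a tangent vector by a curve.\<close>

lemma level_curve_rescale:
  fixes p v :: "'a::real_normed_vector"
  assumes "\<epsilon> > 0"
    and M: "\<And>t. \<bar>t\<bar> < \<epsilon> \<Longrightarrow> (M has_real_derivative M' t) (at t)"
    and M': "\<And>t. \<bar>t\<bar> < \<epsilon> \<Longrightarrow> (M' has_real_derivative M'' t) (at t)"
    and cont: "continuous_on {-\<epsilon><..<\<epsilon>} M''"
    and pos: "\<And>t. \<bar>t\<bar> < \<epsilon> \<Longrightarrow> M t > 0"
    and 0: "M 0 = 1" "M' 0 = 0"
    and g: "\<And>t. \<bar>t\<bar> < \<epsilon> \<Longrightarrow> g ((1 / M t) *\<^sub>R (p + t *\<^sub>R v)) = g p"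
  shows "level_curve g p v (\<lambda>t. (1 / M t) *\<^sub>R (p + t *\<^sub>R v))"
proof -
  define \<gamma>' where "\<gamma>' t = (1 / M t) *\<^sub>R v - (M' t / (M t)\<^sup>2) *\<^sub>R (p + t *\<^sub>R v)" for t
  define \<gamma>'' where "\<gamma>'' t = - (M' t / (M t)\<^sup>2) *\<^sub>R v - (M' t / (M t)\<^sup>2) *\<^sub>R v -
    (M'' t / (M t)\<^sup>2 - 2 * (M' t)\<^sup>2 / (M t) ^ 3) *\<^sub>R (p + t *\<^sub>R v)" for t
  have abs: "t \<in> {-\<epsilon><..<\<epsilon>} \<longleftrightarrow> \<bar>t\<bar> < \<epsilon>" for t by (auto simp: abs_less_iff)
  have line: "((\<lambda>t. p + t *\<^sub>R v) has_vector_derivative v) (at t)" for t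
    by (auto intro!: derivative_eq_intros)
  have inv: "((\<lambda>t. 1 / M t) has_real_derivative - (M' t / (M t)\<^sup>2)) (at t)" if "\<bar>t\<bar> < \<epsilon>" for t
    using pos[OF that]
    by (auto intro!: derivative_eq_intros M that simp: power2_eq_square)
  have quo: "((\<lambda>t. M' t / (M t)\<^sup>2) has_real_derivative (M'' t / (M t)\<^sup>2 - 2 * (M' t)\<^sup>2 / (M t) ^ 3)) (at t)"
    if "\<bar>t\<bar> < \<epsilon>" for t
    using pos[OF that]
    by (auto intro!: derivative_eq_intros M M' that simp: field_simps power2_eq_square eval_nat_numeral)
  have "((\<lambda>t. (1 / M t) *\<^sub>R (p + t *\<^sub>R v)) has_vector_derivative \<gamma>' t) (at t)" if "\<bar>t\<bar> < \<epsilon>" for t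
    using has_vector_derivative_scaleR[OF inv[OF that] line] by (simp add: \<gamma>'_def)
  moreover have "(\<gamma>' has_vector_derivative \<gamma>'' t) (at t)" if "\<bar>t\<bar> < \<epsilon>" for t
    using has_vector_derivative_diff[OF has_vector_derivative_scaleR[OF inv[OF that] has_vector_derivative_const[of v]]
        has_vector_derivative_scaleR[OF quo[OF that] line]]
    unfolding \<gamma>'_def[abs_def]
    by (rule has_vector_derivative_eq_rhs) (simp add: \<gamma>''_def algebra_simps)
  moreover have "continuous_on {-\<epsilon><..<\<epsilon>} \<gamma>''"
  proof -
    have "continuous_on {-\<epsilon><..<\<epsilon>} M" "continuous_on {-\<epsilon><..<\<epsilon>} M'"
      using DERIV_isCont[OF M] DERIV_isCont[OF M']
      by (auto intro!: continuous_at_imp_continuous_on simp: abs)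
    moreover have "M t \<noteq> 0" if "t \<in> {-\<epsilon><..<\<epsilon>}" for t using pos[of t] that abs[of t] by force
    ultimately show ?thesis
      unfolding \<gamma>''_def by (intro continuous_intros cont) auto
  qed
  ultimately show ?thesis
    unfolding level_curve_def using \<open>\<epsilon> > 0\<close> g 0
    by (intro exI[of _ \<epsilon>] conjI exI[of _ \<gamma>'] exI[of _ \<gamma>'']) (auto simp: abs \<gamma>'_def)
qed

lemma area_scaleR: "area (c *\<^sub>R p) = c\<^sup>2 * area p"
  by (simp add: area_eq area_form_scaleR power2_eq_square)

lemma perimeter_scaleR: "perimeter (c *\<^sub>R p) = \<bar>c\<bar> * perimeter p"
  by (simp add: perimeter_eq sum_distrib_left)

lemma ex_level_curve_area:
  fixes p v :: "(real^2)^'n"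
  assumes area: "area p \<noteq> 0" and v: "area_form p v = 0"
  shows "\<exists>\<gamma>. level_curve area p v \<gamma>"
proof -
  \<comment> \<open>As \<open>area_form p v = 0\<close>, the area along the line is
    \<open>area p * (1 + q * t\<^sup>2)\<close>. Area has degree 2, so the normalising factor is the
    square root.\<close>
  define q where "q = area v / area p"
  define M where "M t = sqrt (1 + q * t\<^sup>2)" for t
  \<comment> \<open>Small enough that \<open>\<bar>t\<bar> < \<epsilon>\<close> gives
    \<open>\<bar>q * t\<^sup>2\<bar> < 1\<close>, using also that \<epsilon> is at most 1.\<close>
  define \<epsilon> where "\<epsilon> = 1 / (1 + \<bar>q\<bar>)"
  have \<epsilon>: "\<epsilon> > 0" "\<epsilon> \<le> 1" "\<bar>q\<bar> * \<epsilon> < 1" by (simp_all add: \<epsilon>_def field_simps)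
  have pos: "1 + q * t\<^sup>2 > 0" if "\<bar>t\<bar> < \<epsilon>" for t
  proof -
    have "t\<^sup>2 \<le> \<bar>t\<bar>"
      using power_decreasing[of 1 2 "\<bar>t\<bar>"] that \<epsilon> by simp
    then have "\<bar>q\<bar> * t\<^sup>2 \<le> \<bar>q\<bar> * \<epsilon>"
      using that by (intro mult_left_mono) auto
    then have "\<bar>q * t\<^sup>2\<bar> < 1" using \<epsilon> by (simp add: abs_mult)
    then show ?thesis by linarith
  qed
  have area_line: "area (p + t *\<^sub>R v) = area p * (1 + q * t\<^sup>2)" for t
  proof -
    have "area (p + t *\<^sub>R v) = area p + t\<^sup>2 * area v"
      using v by (simp add: area_eq area_form_add area_form_scaleR area_form_commute[of v p]
          power2_eq_square add_divide_distrib)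
    then show ?thesis using area by (simp add: q_def field_simps)
  qed
  have "level_curve area p v (\<lambda>t. (1 / M t) *\<^sub>R (p + t *\<^sub>R v))"
  proof (rule level_curve_rescale[OF \<open>\<epsilon> > 0\<close>])
    fix t assume t: "\<bar>t\<bar> < \<epsilon>"
    have Mpos: "M t > 0" "M t * M t = 1 + q * t\<^sup>2" using pos[OF t] by (simp_all add: M_def)
    then show "M t > 0" by simp
    show D: "(M has_real_derivative q * t / M t) (at t)"
      using pos[OF t] unfolding M_def[abs_def]
      by (auto intro!: derivative_eq_intros simp: field_simps)
    show "((\<lambda>t. q * t / M t) has_real_derivative (q / M t - q\<^sup>2 * t\<^sup>2 / (M t) ^ 3)) (at t)"
      using Mpos(1)
      by (auto intro!: derivative_eq_intros D simp: field_simps power2_eq_square eval_nat_numeral)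
    show "area ((1 / M t) *\<^sub>R (p + t *\<^sub>R v)) = area p"
      using Mpos pos[OF t] by (simp add: area_scaleR area_line power_divide power2_eq_square[of "M t"])
  next
    have "isCont M t" for t unfolding M_def[abs_def] by (intro continuous_intros)
    moreover have "M t \<noteq> 0" if "t \<in> {-\<epsilon><..<\<epsilon>}" for t
      using pos[of t] that by (auto simp: M_def abs_less_iff)
    ultimately show "continuous_on {-\<epsilon><..<\<epsilon>} (\<lambda>t. q / M t - q\<^sup>2 * t\<^sup>2 / (M t) ^ 3)"
      by (intro continuous_intros continuous_at_imp_continuous_on) auto
  qed (simp_all add: M_def)
  then show ?thesis by blast
qed

lemma ex_level_curve_perimeter:
  fixes p v :: "(real^2)^'n"
  assumes nz: "\<And>k. edge p k \<noteq> 0" and v: "perimeter_deriv p v = 0"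
  shows "\<exists>\<gamma>. level_curve perimeter p v \<gamma>"
proof -
  define e where "e k t = edge p k + t *\<^sub>R edge v k" for k t
  define P where "P = perimeter p"
  have De: "(e k has_vector_derivative edge v k) (at t)" for k t
    unfolding e_def[abs_def] by (auto intro!: derivative_eq_intros)
  have "\<forall>\<^sub>F t in nhds 0. e k t \<noteq> 0" for k
  proof -
    have "(e k \<longlongrightarrow> e k 0) (nhds 0)"
      using has_vector_derivative_continuous[OF De[of k 0]] tendsto_at_iff_tendsto_nhds[of "e k" 0]
      by (simp add: continuous_at)
    then show ?thesis
      using nz tendsto_imp_eventually_ne[of "e k" "e k 0"] by (simp add: e_def)
  qed
  then have "\<forall>\<^sub>F t in nhds 0. \<forall>k\<in>{..<CARD('n)}. e k t \<noteq> 0"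
    by (intro eventually_ball_finite) auto
  then obtain \<epsilon> where "\<epsilon> > 0" and \<epsilon>: "\<And>k t. \<bar>t\<bar> < \<epsilon> \<Longrightarrow> k < CARD('n) \<Longrightarrow> e k t \<noteq> 0"
    by (auto simp: eventually_nhds_metric dist_real_def)
  \<comment> \<open>Perimeter has degree 1, so the normalising factor is the ratio of perimeters;
    its derivative at 0 vanishes by the assumption on \<open>v\<close>.\<close>
  define M where "M t = (\<Sum>k<CARD('n). norm (e k t)) / P" for t
  define M' where "M' t = (\<Sum>k<CARD('n). sgn (e k t) \<bullet> edge v k) / P" for t
  define M'' where "M'' t = (\<Sum>k<CARD('n). (rot (sgn (e k t)) \<bullet> edge v k)\<^sup>2 / norm (e k t)) / P" for t
  have perim: "perimeter (p + t *\<^sub>R v) = (\<Sum>k<CARD('n). norm (e k t))" for t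
    by (simp add: perimeter_eq e_def)
  have ne: "{..<CARD('n)} \<noteq> {}"
    by (metis empty_iff lessThan_iff zero_less_card_finite)
  have P: "P > 0"
    unfolding P_def perimeter_eq using nz ne by (intro sum_pos) auto
  have "level_curve perimeter p v (\<lambda>t. (1 / M t) *\<^sub>R (p + t *\<^sub>R v))"
  proof (rule level_curve_rescale[OF \<open>\<epsilon> > 0\<close>, of _ M' M''])
    fix t assume t: "\<bar>t\<bar> < \<epsilon>"
    show "(M has_real_derivative M' t) (at t)"
      unfolding M_def[abs_def] M'_def using t
      by (intro DERIV_cdivide DERIV_sum has_real_derivative_norm_compose De \<epsilon>) auto
    have "((\<lambda>t. sgn (e k t) \<bullet> edge v k) has_real_derivative
        (rot (sgn (e k t)) \<bullet> edge v k)\<^sup>2 / norm (e k t)) (at t)" if "k < CARD('n)" for k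
      using has_real_derivative_sgn_inner[OF De[of k t] has_vector_derivative_const \<epsilon>[OF t that]] by simp
    then show "(M' has_real_derivative M'' t) (at t)"
      unfolding M'_def[abs_def] M''_def by (intro DERIV_cdivide DERIV_sum) auto
    show "M t > 0"
      unfolding M_def using P \<epsilon>[OF t] ne by (intro divide_pos_pos sum_pos) auto
    then have "(\<Sum>k<CARD('n). norm (e k t)) > 0"
      using P by (simp add: M_def zero_less_divide_iff)
    then show "perimeter ((1 / M t) *\<^sub>R (p + t *\<^sub>R v)) = perimeter p"
      using P by (simp add: perimeter_scaleR perim M_def P_def)
  next
    have "continuous_on {-\<epsilon><..<\<epsilon>} (e k)" for k
      unfolding e_def by (intro continuous_intros)
    moreover have "e k t \<noteq> 0" if "t \<in> {-\<epsilon><..<\<epsilon>}" "k < CARD('n)" for k t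
      using that by (intro \<epsilon>) auto
    moreover have "bounded_linear rot"
      by (rule linear_conv_bounded_linear[THEN iffD1]) (simp add: linear_iff)
    ultimately show "continuous_on {-\<epsilon><..<\<epsilon>} M''"
      unfolding M''_def using P
      by (intro continuous_intros bounded_linear.continuous_on[of rot] continuous_on_sgn) auto
  next
    show "M 0 = 1" using P perim[of 0] by (simp add: M_def P_def)
    show "M' 0 = 0" using v by (simp add: M'_def perimeter_deriv_def e_def edge_dir_def)
  qed
  then show ?thesis by blast
qed

section \<open>Tangent spaces, Hessians and indices of the two restrictions\<close>

lemma level_tangent_space_area:
  assumes st: "stationary p \<mu>" and area: "area p \<noteq> 0"
  shows "level_tangent_space area p = level_tangent p"
proof -
  have "area_form p v = 0" if "level_curve area p v \<gamma>" for v \<gamma>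
    using st level_curve_expansion[OF _ that] level_curve_derivatives[OF that]
    unfolding stationary_def by metis
  then show ?thesis
    using ex_level_curve_area[OF area] by (auto simp: level_tangent_space_def level_tangent_def)
qed

lemma level_tangent_space_perimeter:
  assumes st: "stationary p \<mu>" and \<mu>: "\<mu> \<noteq> 0"
  shows "level_tangent_space perimeter p = level_tangent p"
proof -
  have "perimeter_deriv p v = 0" if "level_curve perimeter p v \<gamma>" for v \<gamma>
    using st level_curve_expansion[OF _ that] level_curve_derivatives[OF that]
    unfolding stationary_def by metis
  moreover have "perimeter_deriv p v = 0 \<longleftrightarrow> area_form p v = 0" for v
    using st \<mu> by (simp add: stationary_def)
  ultimately show ?thesis
    using ex_level_curve_perimeter[of p] st
    by (auto simp: level_tangent_space_def level_tangent_def stationary_def)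
qed

text \<open>Constant area gives \<open>area_form p w = - area_form v v\<close> for the acceleration
  \<open>w\<close>, and stationarity turns this into the first-order term of perimeter. The value is
  the same for every curve, and one curve exists, so the description by \<open>THE\<close> is
  met.\<close>

lemma level_hessian_perimeter:
  assumes st: "stationary p \<mu>" and area: "area p \<noteq> 0" and v: "v \<in> level_tangent p"
  shows "level_hessian perimeter area p v = lagrangian_hessian p \<mu> v v"
proof -
  have nz: "edge p k \<noteq> 0" for k using st by (simp add: stationary_def)
  have uniq: "deriv (deriv (perimeter \<circ> \<gamma>)) 0 = lagrangian_hessian p \<mu> v v"
    if curve: "level_curve area p v \<gamma>" for \<gamma>
  proof -
    obtain w where w: "deriv (deriv (perimeter \<circ> \<gamma>)) 0 = perimeter_hessian p v v + perimeter_deriv p w"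
      "deriv (deriv (area \<circ> \<gamma>)) 0 = area_form v v + area_form p w"
      by (rule level_curve_expansion[OF nz curve]) blast
    have "area_form p w = - area_form v v"
      using w(2) level_curve_derivatives(2)[OF curve] by simp
    then show ?thesis
      using st w(1) by (simp add: stationary_def lagrangian_hessian_def)
  qed
  obtain \<gamma> where "level_curve area p v \<gamma>"
    using ex_level_curve_area[OF area] v by (auto simp: level_tangent_def)
  then show ?thesis
    unfolding level_hessian_def using uniq by (intro the_equality) (auto intro!: exI[of _ \<gamma>])
qed

text \<open>Here constant perimeter determines \<open>\<mu> * area_form p w\<close>, and solving for
  the area term produces the factor \<open>- 1 / \<mu>\<close>.\<close>

lemma level_hessian_area:
  assumes st: "stationary p \<mu>" and \<mu>: "\<mu> \<noteq> 0" and v: "v \<in> level_tangent p"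
  shows "level_hessian area perimeter p v = - lagrangian_hessian p \<mu> v v / \<mu>"
proof -
  have nz: "edge p k \<noteq> 0" for k using st by (simp add: stationary_def)
  have uniq: "deriv (deriv (area \<circ> \<gamma>)) 0 = - lagrangian_hessian p \<mu> v v / \<mu>"
    if curve: "level_curve perimeter p v \<gamma>" for \<gamma>
  proof -
    obtain w where w: "deriv (deriv (perimeter \<circ> \<gamma>)) 0 = perimeter_hessian p v v + perimeter_deriv p w"
      "deriv (deriv (area \<circ> \<gamma>)) 0 = area_form v v + area_form p w"
      by (rule level_curve_expansion[OF nz curve]) blast
    have "\<mu> * area_form p w = - perimeter_hessian p v v"
      using w(1) level_curve_derivatives(2)[OF curve] st by (simp add: stationary_def)
    then show ?thesis
      using \<mu> by (simp add: w(2) lagrangian_hessian_def field_simps)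
  qed
  have "perimeter_deriv p v = 0"
    using st v by (simp add: stationary_def level_tangent_def)
  then obtain \<gamma> where "level_curve perimeter p v \<gamma>"
    using ex_level_curve_perimeter[of p v] st by (auto simp: stationary_def)
  then show ?thesis
    unfolding level_hessian_def using uniq by (intro the_equality) (auto intro!: exI[of _ \<gamma>])
qed

lemma morse_index_perimeter:
  assumes "stationary p \<mu>" "area p \<noteq> 0"
  shows "morse_index perimeter area p = Max {dim V |V. subspace V \<and> V \<subseteq> level_tangent p \<and>
    (\<forall>v\<in>V - {0}. lagrangian_hessian p \<mu> v v < 0)}"
  unfolding morse_index_def level_tangent_space_area[OF assms]
  using level_hessian_perimeter[OF assms]
  by (intro arg_cong[of _ _ Max] Collect_cong ex_cong1 conj_cong refl ball_cong)
    (auto simp: subset_iff)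

lemma morse_index_area:
  assumes "stationary p \<mu>" "\<mu> \<noteq> 0"
  shows "morse_index area perimeter p = Max {dim V |V. subspace V \<and> V \<subseteq> level_tangent p \<and>
    (\<forall>v\<in>V - {0}. - lagrangian_hessian p \<mu> v v / \<mu> < 0)}"
  unfolding morse_index_def level_tangent_space_perimeter[OF assms]
  using level_hessian_area[OF assms]
  by (intro arg_cong[of _ _ Max] Collect_cong ex_cong1 conj_cong refl ball_cong)
    (auto simp: subset_iff)

section \<open>Effect of scaling on tangent space and form\<close>

lemma level_tangent_scaleR:
  assumes "s \<noteq> 0"
  shows "level_tangent (s *\<^sub>R p) = level_tangent p"
proof -
  have sub: "orbit_directions (r *\<^sub>R q) \<subseteq> orbit_directions q" for r and q :: "(real^2)^'a"
  proof -
    have "(\<chi> i. b) + c *\<^sub>R rot_tuple (r *\<^sub>R q) = (\<chi> i. b) + (c * r) *\<^sub>R rot_tuple q" for b c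
      by (simp add: rot_tuple_def vec_eq_iff)
    then show ?thesis unfolding orbit_directions_eq by blast
  qed
  have "orbit_directions (s *\<^sub>R p) = orbit_directions p"
    using sub[of s p] sub[of "1 / s" "s *\<^sub>R p"] assms by simp
  then show ?thesis
    using assms by (simp add: level_tangent_def area_form_scaleR)
qed

text \<open>The perimeter Hessian has degree -1 in \<open>p\<close>, and the area form is
  independent of \<open>p\<close>; the new multiplier gives both terms the same positive factor, so
  signs persist.\<close>

lemma lagrangian_hessian_scaleR:
  assumes "s > 0"
  shows "lagrangian_hessian (s *\<^sub>R p) (\<mu> / s) v w = lagrangian_hessian p \<mu> v w / s"
proof -
  have "edge_dir (s *\<^sub>R p) k = edge_dir p k" for k
    using assms by (simp add: edge_dir_def sgn_scaleR)
  then show ?thesis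
    using assms by (simp add: lagrangian_hessian_def perimeter_hessian_def sum_divide_distrib
        diff_divide_distrib mult.commute)
qed

section \<open>Rescaling polygons\<close>

lift_definition polygon_scale :: "real \<Rightarrow> 'n::finite polygon \<Rightarrow> 'n polygon"
  is "\<lambda>r p. r *\<^sub>R p"
proof -
  fix r :: real and p q :: "(real^2)^'n"
  assume "congruent_tuples p q"
  then obtain Q b where "rotation_matrix Q" "\<And>i. q $ i = Q *v (p $ i) + b"
    unfolding congruent_tuples_def by blast
  then have "rotation_matrix Q \<and> (\<forall>i. (r *\<^sub>R q) $ i = Q *v ((r *\<^sub>R p) $ i) + r *\<^sub>R b)"
    by (simp add: scaleR_add_right matrix_vector_mult_scaleR)
  then show "congruent_tuples (r *\<^sub>R p) (r *\<^sub>R q)"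
    unfolding congruent_tuples_def by blast
qed

lemma polygon_scale_scale [simp]: "polygon_scale r (polygon_scale s X) = polygon_scale (r * s) X"
  by transfer (simp add: congruent_tuples_refl)

lemma polygon_scale_1 [simp]: "polygon_scale 1 X = X"
  by transfer (simp add: congruent_tuples_refl)

lemma polygon_area_scale [simp]: "polygon_area (polygon_scale r X) = r\<^sup>2 * polygon_area X"
  by transfer (rule area_scaleR)

lemma polygon_perimeter_scale [simp]:
  "polygon_perimeter (polygon_scale r X) = \<bar>r\<bar> * polygon_perimeter X"
  by transfer (rule perimeter_scaleR)

lemma polygon_area_nz_imp:
  assumes "polygon_area X \<noteq> 0"
  shows "X \<in> ngons" "polygon_perimeter X > 0"
proof -
  obtain p where p: "X = polygon_of p"
    by (metis Quotient_abs_rep Quotient_polygon)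
  have area: "area p \<noteq> 0" using assms by (simp add: p polygon_area.abs_eq)
  show "polygon_perimeter X > 0"
    using perimeter_pos[OF area] by (simp add: p polygon_perimeter.abs_eq)
  have "\<exists>i j. p $ i \<noteq> p $ j"
  proof (rule ccontr)
    assume "\<not> ?thesis"
    then have "edge p k = 0" for k by (simp add: edge_def vertex_def)
    then show False using ex_nonzero_edge[OF area] by blast
  qed
  then show "X \<in> ngons" unfolding ngons_def p by blast
qed

section \<open>Continuity on the quotient space\<close>

text \<open>The universal property of the quotient topology over an open set, where preimages of
  open sets are open in the whole space.\<close>

lemma continuous_on_polygon:
  assumes U: "open U" and f: "continuous_on (polygon_of -` U) (\<lambda>p. f (polygon_of p))"
  shows "continuous_on U f"
proof -
  have U': "open (polygon_of -` U)" using U by (simp add: open_polygon_def)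
  have "open (f -` B \<inter> U)" if "open B" for B
  proof -
    have "open ((\<lambda>p. f (polygon_of p)) -` B \<inter> polygon_of -` U)"
      using f U' that continuous_on_open_vimage by blast
    then show ?thesis by (simp add: open_polygon_def vimage_def Int_def)
  qed
  then show ?thesis using U continuous_on_open_vimage by blast
qed

lemma continuous_on_polygon_of: "continuous_on S (polygon_of :: (real^2)^'n::finite \<Rightarrow> _)"
proof -
  have "continuous_on UNIV (polygon_of :: (real^2)^'n::finite \<Rightarrow> _)"
    by (simp add: continuous_on_open_vimage open_polygon_def)
  then show ?thesis by (rule continuous_on_subset) simp
qed

lemma continuous_on_perimeter: "continuous_on S (perimeter :: (real^2)^'n::finite \<Rightarrow> real)"
  unfolding perimeter_eq[abs_def]
  by (intro continuous_intros bounded_linear.continuous_on[OF bounded_linear_edge])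

lemma continuous_on_area: "continuous_on S (area :: (real^2)^'n::finite \<Rightarrow> real)"
  unfolding area_eq[abs_def]
  by (intro continuous_intros bounded_bilinear.continuous_on[OF bounded_bilinear_area_form]) auto

lemma continuous_on_polygon_perimeter: "continuous_on UNIV polygon_perimeter"
  by (rule continuous_on_polygon) (simp_all add: polygon_perimeter.abs_eq continuous_on_perimeter)

lemma continuous_on_polygon_area: "continuous_on UNIV polygon_area"
  by (rule continuous_on_polygon) (simp_all add: polygon_area.abs_eq continuous_on_area)

lemma continuous_on_polygon_scale:
  fixes f :: "'n::finite polygon \<Rightarrow> real"
  assumes U: "open U" and f: "continuous_on U f"
  shows "continuous_on U (\<lambda>X. polygon_scale (f X) X)"
proof (rule continuous_on_polygon[OF U])
  have "continuous_on (polygon_of -` U) (\<lambda>p. f (polygon_of p))"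
    by (rule continuous_on_compose2[OF f continuous_on_polygon_of]) auto
  then have "continuous_on (polygon_of -` U) (\<lambda>p. polygon_of (f (polygon_of p) *\<^sub>R p))"
    by (intro continuous_on_compose2[OF continuous_on_polygon_of[of UNIV]] continuous_intros) auto
  then show "continuous_on (polygon_of -` U) (\<lambda>p. polygon_scale (f (polygon_of p)) (polygon_of p))"
    by (simp add: polygon_scale.abs_eq)
qed

text \<open>One direction normalises the perimeter; the other restores the area, hence the square
  root. Comparing \<open>sgn\<close> treats both signs of \<open>a\<close> at once.\<close>

lemma homeomorphism_rescale:
  fixes a c :: real
  assumes a: "a \<noteq> 0" and c: "c > 0"
  shows "homeomorphism (ngons_area a) {X \<in> ngons_perimeter c. sgn (polygon_area X) = sgn a}
    (\<lambda>X. polygon_scale (c / polygon_perimeter X) X)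
    (\<lambda>X. polygon_scale (sqrt (a / polygon_area X)) X)"
    (is "homeomorphism ?A ?C ?f ?g")
proof (rule homeomorphismI)
  have A: "polygon_area X = a" "polygon_perimeter X > 0" if "X \<in> ?A" for X
    using that a polygon_area_nz_imp[of X] by (auto simp: ngons_area_def)
  have C: "polygon_area X \<noteq> 0" "a / polygon_area X > 0" "polygon_perimeter X = c" if "X \<in> ?C" for X
    using that a by (auto simp: ngons_perimeter_def sgn_if zero_less_divide_iff split: if_splits)
  \<comment> \<open>Level sets are not open, so continuity is obtained on an open set containing the
    level set and then restricted.\<close>
  have "open (polygon_perimeter -` {0<..} :: 'a polygon set)"
    by (rule open_vimage[OF open_greaterThan continuous_on_polygon_perimeter])
  then have "continuous_on (polygon_perimeter -` {0<..}) ?f"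
    by (intro continuous_on_polygon_scale continuous_intros
        continuous_on_subset[OF continuous_on_polygon_perimeter]) auto
  then show "continuous_on ?A ?f"
    by (rule continuous_on_subset) (use A in auto)
  have "open (polygon_area -` (- {0}) :: 'a polygon set)"
    by (rule open_vimage[OF _ continuous_on_polygon_area]) auto
  then have "continuous_on (polygon_area -` (- {0})) ?g"
    by (intro continuous_on_polygon_scale continuous_intros
        continuous_on_subset[OF continuous_on_polygon_area]) auto
  then show "continuous_on ?C ?g"
    by (rule continuous_on_subset) (use C in auto)
  show "?f ` ?A \<subseteq> ?C"
  proof clarify
    fix X :: "'a polygon" assume X: "X \<in> ?A"
    have "polygon_area (?f X) = (c / polygon_perimeter X)\<^sup>2 * a" using A[OF X] by simp
    moreover have "(c / polygon_perimeter X)\<^sup>2 > 0" using A[OF X] c by simp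
    ultimately have "sgn (polygon_area (?f X)) = sgn a" by (simp only: sgn_mult sgn_pos)
    then show "?f X \<in> ngons_perimeter c \<and> sgn (polygon_area (?f X)) = sgn a"
      using A[OF X] a c polygon_area_nz_imp(1)[of "?f X"]
      by (auto simp: ngons_perimeter_def)
  qed
  show "?g ` ?C \<subseteq> ?A"
  proof
    fix Y assume "Y \<in> ?g ` ?C"
    then obtain X where X: "X \<in> ?C" "Y = ?g X" by blast
    then have "polygon_area Y = a" using C[OF X(1)] by simp
    then show "Y \<in> ?A" using a polygon_area_nz_imp(1)[of Y] by (simp add: ngons_area_def)
  qed
  show "?g (?f X) = X" if "X \<in> ?A" for X
  proof -
    have "sqrt (a / polygon_area (?f X)) * (c / polygon_perimeter X) = 1"
      using A[OF that] a c by (simp add: real_sqrt_divide power_divide)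
    then show ?thesis by simp
  qed
  show "?f (?g X) = X" if "X \<in> ?C" for X
  proof -
    have "c / polygon_perimeter (?g X) * sqrt (a / polygon_area X) = 1"
      using C[OF that] a c by simp
    then show ?thesis by (simp only: polygon_scale_scale polygon_scale_1)
  qed
qed

lemma homeomorphism_inverse_square:
  fixes b :: real
  assumes "b \<noteq> 0"
  shows "homeomorphism {0<..} {y. sgn y = sgn b} (\<lambda>x. b / x\<^sup>2) (\<lambda>y. sqrt (b / y))"
proof (rule homeomorphismI)
  show "continuous_on {0<..} (\<lambda>x. b / x\<^sup>2)"
    by (intro continuous_intros) auto
  show "continuous_on {y. sgn y = sgn b} (\<lambda>y. sqrt (b / y))"
    using assms by (intro continuous_intros) (auto simp: sgn_0_0)
  show "(\<lambda>x. b / x\<^sup>2) ` {0<..} \<subseteq> {y. sgn y = sgn b}"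
    by (auto simp: sgn_divide)
  show "(\<lambda>y. sqrt (b / y)) ` {y. sgn y = sgn b} \<subseteq> {0<..}"
    using assms by (auto simp: sgn_if zero_less_divide_iff split: if_splits)
  show "sqrt (b / (b / x\<^sup>2)) = x" if "x \<in> {0<..}" for x
    using that assms by simp
  show "b / (sqrt (b / y))\<^sup>2 = y" if "y \<in> {y. sgn y = sgn b}" for y
  proof -
    have "b / y > 0" using that assms by (auto simp: sgn_if zero_less_divide_iff split: if_splits)
    then have "(sqrt (b / y))\<^sup>2 = b / y" by (intro real_sqrt_pow2) simp
    then show ?thesis using assms by simp
  qed
qed

text \<open>The tangent spaces at \<open>p\<close> and \<open>s p\<close> agree and the forms differ
  by a positive factor, so the index of area at \<open>s p\<close> is that of
  \<open>- H / \<mu>\<close> at \<open>p\<close>, where \<mu> has the sign of the area. The bound on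
  \<open>i\<close> keeps the subtraction from being truncated.\<close>

lemma morse_point_rescale:
  fixes X :: "'n::finite polygon"
  assumes X: "polygon_area X \<noteq> 0" and s: "s > 0"
    and morse: "morse_point perimeter area X i"
  shows "polygon_area X > 0 \<Longrightarrow> i \<le> 2 * CARD('n) - 4 \<and>
      morse_point area perimeter (polygon_scale s X) (2 * CARD('n) - 4 - i)"
    and "polygon_area X < 0 \<Longrightarrow> morse_point area perimeter (polygon_scale s X) i"
proof -
  obtain p where p: "X = polygon_of p" "clarke_critical_on_level perimeter area p"
    and i: "morse_index perimeter area p = i"
    using morse unfolding morse_point_def by blast
  have area: "area p \<noteq> 0" "polygon_area X = area p"
    using X by (simp_all add: p polygon_area.abs_eq)
  define \<mu> where "\<mu> = perimeter p / (2 * area p)"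
  have st: "stationary p \<mu>"
    unfolding \<mu>_def by (intro critical_imp_stationary area p)
  have \<mu>: "\<mu> \<noteq> 0" "sgn \<mu> = sgn (area p)"
    using perimeter_pos[OF area(1)] area by (simp_all add: \<mu>_def sgn_divide sgn_mult)
  have st_s: "stationary (s *\<^sub>R p) (\<mu> / s)" by (rule stationary_scaleR[OF st s])
  have \<mu>_s: "\<mu> / s \<noteq> 0" using \<mu> s by simp
  let ?H = "lagrangian_hessian p \<mu>"
  have idx: "morse_index area perimeter (s *\<^sub>R p) = Max {dim V |V. subspace V \<and>
      V \<subseteq> level_tangent p \<and> (\<forall>v\<in>V - {0}. - ?H v v / \<mu> < 0)}"
    using s by (simp add: morse_index_area[OF st_s \<mu>_s] level_tangent_scaleR lagrangian_hessian_scaleR)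
  have point: "morse_point area perimeter (polygon_scale s X) (morse_index area perimeter (s *\<^sub>R p))"
    unfolding morse_point_def p polygon_scale.abs_eq
    using stationary_imp_critical[OF st_s \<mu>_s] by blast
  have i_eq: "i = Max {dim V |V. subspace V \<and> V \<subseteq> level_tangent p \<and> (\<forall>v\<in>V - {0}. ?H v v < 0)}"
    using i morse_index_perimeter[OF st area(1)] by simp
  {
    assume "polygon_area X < 0"
    then have "\<mu> < 0" using \<mu> area by (simp add: sgn_if split: if_splits)
    then have "- x / \<mu> < 0 \<longleftrightarrow> x < 0" for x
      by (simp add: zero_less_divide_iff divide_less_0_iff)
    then have "morse_index area perimeter (s *\<^sub>R p) = i"
      unfolding idx i_eq by simp
    then show "morse_point area perimeter (polygon_scale s X) i"
      using point by simp
  }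
  assume "polygon_area X > 0"
  then have "\<mu> > 0" using \<mu> area by (simp add: sgn_if split: if_splits)
  then have "- x / \<mu> < 0 \<longleftrightarrow> x > 0" for x
    by (simp add: zero_less_divide_iff divide_less_0_iff)
  then have "morse_index area perimeter (s *\<^sub>R p) = Max {dim V |V. subspace V \<and>
      V \<subseteq> level_tangent p \<and> (\<forall>v\<in>V - {0}. ?H v v > 0)}"
    unfolding idx by simp
  moreover have "i + Max {dim V |V. subspace V \<and>
      V \<subseteq> level_tangent p \<and> (\<forall>v\<in>V - {0}. ?H v v > 0)} = dim (level_tangent p)"
    unfolding i_eq
    by (rule index_add_coindex[OF subspace_level_tangent bilinear_lagrangian_hessian
          lagrangian_hessian_commute lagrangian_hessian_nondegenerate[OF st \<mu>(1) area(1)]])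
  ultimately have "i + morse_index area perimeter (s *\<^sub>R p) = 2 * CARD('n) - 4"
    using dim_level_tangent[OF area(1)] by simp
  then show "i \<le> 2 * CARD('n) - 4 \<and>
      morse_point area perimeter (polygon_scale s X) (2 * CARD('n) - 4 - i)"
    using point by (metis add_diff_cancel_left' le_add1)
qed

theorem theorem3:
  fixes a \<pi> :: real
  assumes "CARD('n::finite) \<ge> 3" and "\<pi> > 0"
  shows
    "(a > 0 \<longrightarrow>
       (\<exists>(\<Psi> :: 'n polygon \<Rightarrow> 'n polygon) \<Psi>' h h'.
          homeomorphism (ngons_area a) {X \<in> ngons_perimeter \<pi>. polygon_area X > 0} \<Psi> \<Psi>' \<and>
          homeomorphism {0<..} {0<..} h h' \<and>
          (\<forall>X \<in> ngons_area a. polygon_area (\<Psi> X) = h (polygon_perimeter X)) \<and>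
          (\<forall>X \<in> ngons_area a. \<forall>i. morse_point perimeter area X i \<longrightarrow>
             i \<le> 2 * CARD('n) - 4 \<and>
             morse_point area perimeter (\<Psi> X) (2 * CARD('n) - 4 - i)))) \<and>
     (a < 0 \<longrightarrow>
       (\<exists>(\<Psi> :: 'n polygon \<Rightarrow> 'n polygon) \<Psi>' h h'.
          homeomorphism (ngons_area a) {X \<in> ngons_perimeter \<pi>. polygon_area X < 0} \<Psi> \<Psi>' \<and>
          homeomorphism {0<..} {..<0} h h' \<and>
          (\<forall>X \<in> ngons_area a. polygon_area (\<Psi> X) = h (polygon_perimeter X)) \<and>
          (\<forall>X \<in> ngons_area a. \<forall>i. morse_point perimeter area X i \<longrightarrow>
             morse_point area perimeter (\<Psi> X) i)))"
proof -
  define \<Psi> where "\<Psi> X = polygon_scale (\<pi> / polygon_perimeter X) X" for X :: "'n polygon"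
  define \<Psi>' where "\<Psi>' X = polygon_scale (sqrt (a / polygon_area X)) X" for X :: "'n polygon"
  \<comment> \<open>Scaling by \<open>\<pi> / x\<close> multiplies the area \<open>a\<close> by the
    square of that factor.\<close>
  define h where "h x = \<pi>\<^sup>2 * a / x\<^sup>2" for x :: real
  define h' where "h' y = sqrt (\<pi>\<^sup>2 * a / y)" for y :: real
  have level: "\<forall>X\<in>ngons_area a. polygon_area (\<Psi> X) = h (polygon_perimeter X)"
    by (simp add: ngons_area_def \<Psi>_def h_def power_divide)
  have hom: "homeomorphism (ngons_area a) {X \<in> ngons_perimeter \<pi>. sgn (polygon_area X) = sgn a} \<Psi> \<Psi>'"
    if "a \<noteq> 0"
    unfolding \<Psi>_def \<Psi>'_def by (rule homeomorphism_rescale[OF that assms(2)])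
  have hom_h: "homeomorphism {0<..} {y. sgn y = sgn a} h h'" if "a \<noteq> 0"
    using homeomorphism_inverse_square[of "\<pi>\<^sup>2 * a"] that assms(2)
    by (simp add: h_def[abs_def] h'_def[abs_def] sgn_mult)
  have morse: "i \<le> 2 * CARD('n) - 4 \<and> morse_point area perimeter (\<Psi> X) (2 * CARD('n) - 4 - i)"
    if "a > 0" "X \<in> ngons_area a" "morse_point perimeter area X i" for X i
    unfolding \<Psi>_def using that assms polygon_area_nz_imp[of X]
    by (intro morse_point_rescale(1)) (auto simp: ngons_area_def)
  have morse': "morse_point area perimeter (\<Psi> X) i"
    if "a < 0" "X \<in> ngons_area a" "morse_point perimeter area X i" for X i
    unfolding \<Psi>_def using that assms polygon_area_nz_imp[of X]
    by (intro morse_point_rescale(2)) (auto simp: ngons_area_def)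
  show ?thesis
  proof (intro conjI impI)
    assume "a > 0"
    with hom hom_h have "homeomorphism (ngons_area a) {X \<in> ngons_perimeter \<pi>. polygon_area X > 0} \<Psi> \<Psi>'"
      "homeomorphism {0<..} {0<..} h h'"
      by (simp_all add: sgn_1_pos sgn_1_neg greaterThan_def lessThan_def)
    with level morse[OF \<open>a > 0\<close>] show "\<exists>(\<Psi> :: 'n polygon \<Rightarrow> 'n polygon) \<Psi>' h h'.
          homeomorphism (ngons_area a) {X \<in> ngons_perimeter \<pi>. polygon_area X > 0} \<Psi> \<Psi>' \<and>
          homeomorphism {0<..} {0<..} h h' \<and>
          (\<forall>X \<in> ngons_area a. polygon_area (\<Psi> X) = h (polygon_perimeter X)) \<and>
          (\<forall>X \<in> ngons_area a. \<forall>i. morse_point perimeter area X i \<longrightarrow>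
             i \<le> 2 * CARD('n) - 4 \<and>
             morse_point area perimeter (\<Psi> X) (2 * CARD('n) - 4 - i))"
      by blast
  next
    assume "a < 0"
    with hom hom_h have "homeomorphism (ngons_area a) {X \<in> ngons_perimeter \<pi>. polygon_area X < 0} \<Psi> \<Psi>'"
      "homeomorphism {0<..} {..<0} h h'"
      by (simp_all add: sgn_1_pos sgn_1_neg greaterThan_def lessThan_def)
    with level morse'[OF \<open>a < 0\<close>] show "\<exists>(\<Psi> :: 'n polygon \<Rightarrow> 'n polygon) \<Psi>' h h'.
          homeomorphism (ngons_area a) {X \<in> ngons_perimeter \<pi>. polygon_area X < 0} \<Psi> \<Psi>' \<and>
          homeomorphism {0<..} {..<0} h h' \<and>
          (\<forall>X \<in> ngons_area a. polygon_area (\<Psi> X) = h (polygon_perimeter X)) \<and>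
          (\<forall>X \<in> ngons_area a. \<forall>i. morse_point perimeter area X i \<longrightarrow>
             morse_point area perimeter (\<Psi> X) i)"
      by blast
  qed
qed

end
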